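(* Let $L\ge m>0$, let $f\in S(m,L)$ be a function on $\mathbb{R}^d$, and let $\Omega\subseteq\mathbb{R}^d$ be a nonempty closed convex set. Consider a first-order algorithm in the transformed form $(\tilde A,\tilde B,\tilde C)$, a filter $\Psi$, and the augmented matrices $(\hat A,\hat B,\hat C,\hat D)$ as described in the context. Suppose that Assumption A ($C_1=c_1I_d\prec 0$) and Assumption B (existence of $M$, $\rho\in(0,1)$ and $\mathbf{P}=\mathbf{P}^\top\succ0$ with the truncated hard IQC and the LMI) hold, so that the unconstrained algorithm $\tilde\xi_{k+1}=\tilde A\tilde\xi_k+\tilde B\nabla f(y_k)$, $y_k=\tilde C\tilde\xi_k$, is R-linearly convergent with rate $\rho$. Let $\mathcal{D}=\Omega\times\mathbb{R}^{(n+p-1)d}$. Then the projected algorithm $$x_{k+\frac12}=\hat A x_k+\hat B u_k,\qquad u_k=\nabla f(y_k),\qquad y_k=x_k^{(1)},\qquad x_{k+1}=\Pi^{\mathbf{P}}_{\mathcal{D}}\big(x_{k+\frac12}\big)$$ is also R-linearly convergent with the same rate $\rho$: for every initial state $x_0\in\mathbb{R}^{(n+p)d}$ there is a constant $c>0$ such that $\|x_k-x_*\|_2\le c\,\rho^k$ for all $k\ge0$, where $x_*$ is the fixed point of the projected algorithm, i.e. $x_*=\Pi^{\mathbf{P}}_{\mathcal{D}}(\hat A x_*+\hat B\nabla f(x_*^{(1)}))$, whose first block $y_*=x_*^{(1)}$ is the optimal solution of $\text{minimize}_{y\in\Omega}f(y)$.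
   Context: **Function class.** $S(m,L)$ is the set of differentiable $f:\mathbb{R}^d\to\mathbb{R}$ with $m\|x-y\|_2^2\le(\nabla f(x)-\nabla f(y))^\top(x-y)\le L\|x-y\|_2^2$ for all $x,y\in\mathbb{R}^d$ (differentiable, $m$-strongly convex and $L$-Lipschitz smooth). **R-linear convergence.** A sequence $(x_k)$ converges R-linearly to $x_*$ with rate $\rho\in(0,1)$ if there is $c>0$ with $\|x_k-x_*\|\le c\rho^k$ for all $k\ge0$. **Weighted projection.** For $P\succ0$ and a nonempty closed convex set $\mathcal{D}$, $\|x\|_P=\sqrt{x^\top Px}$ and $\Pi^P_{\mathcal{D}}(x)=\operatorname{argmin}_{z\in\mathcal{D}}\|z-x\|_P^2$. **Algorithm.** Let $n>1$. The unconstrained first-order algorithm has state $\xi_k=(\xi^{(1)}_k,\xi^{(2)}_k)\in\mathbb{R}^d\times\mathbb{R}^{(n-1)d}$ and is $$\xi^{(1)}_{k+1}=\xi^{(1)}_k+u_k,\quad \xi^{(2)}_{k+1}=A_{21}\xi^{(1)}_k+A_{22}\xi^{(2)}_k,\quad y_k=C_1\xi^{(1)}_k+C_2\xi^{(2)}_k,\quad u_k=\nabla f(y_k).$$ All matrices are of the form $(\cdot)\otimes I_d$; in particular $C_1=c_1I_d$ with $c_1\in\mathbb{R}$. *Assumption A:* $C_1=c_1I_d\prec0$, i.e. $c_1<0$. With $\tilde\xi_k=\begin{bmatrix} C_1 & C_2 \\ 0 & I \end{bmatrix}\xi_k=(y_k,\xi_k^{(2)})$ the system becomes $\tilde\xi_{k+1}=\tilde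 A\tilde\xi_k+\tilde Bu_k$, $y_k=\tilde C\tilde\xi_k$, where $$\tilde A=\begin{bmatrix} C_1 & C_2 \\ 0 & I \end{bmatrix}\begin{bmatrix} I_d & 0 \\ A_{21} & A_{22} \end{bmatrix}\begin{bmatrix} C_1 & C_2 \\ 0 & I \end{bmatrix}^{-1},\quad \tilde B=\begin{bmatrix} C_1 \\ 0 \end{bmatrix},\quad \tilde C=\begin{bmatrix} I_d & 0 \end{bmatrix},\quad \tilde D=0.$$ **Filter.** $\Psi$ is a stable linear system ($A_\Psi$ Schur stable, all matrices of the form $(\cdot)\otimes I_d$) with state $\zeta_k\in\mathbb{R}^{pd}$ and output $h_k\in\mathbb{R}^{qd}$: $$\zeta_{k+1}=A_\Psi\zeta_k+B^y_\Psi y_k+B^u_\Psi u_k,\quad h_k=C_\Psi\zeta_k+D^y_\Psi y_k+D^u_\Psi u_k .$$ For each $(y_*,u_* )$, $(\zeta_*,h_* )$ denotes its unique fixed point under the constant input $(y_*,u_* )$. **Truncated hard IQC for symmetric $M\in\mathbb{R}^{qd\times qd}$.** For every $f\in S(m,L)$, every $\zeta_0\in\mathbb{R}^{pd}$, every sequence $(y_k)$ in $\mathbb{R}^d$ with $u_k=\nabla f(y_k)$, every $y_*\in\mathbb{R}^d$ with $u_*=\nabla f(y_* )$, and all integers $T\ge t\ge0$: $\sum_{k=t}^{T}(h_k-h_* )^\top M(h_k-h_* )\ge0$. **Augmented system.** State $x_k=(\tilde\xi_k,\zeta_k)\in\mathbb{R}^{(n+p)d}$, with $x^{(1)}\in\mathbb{R}^d$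 its first block (equal to $y$) and $$\hat A=\begin{bmatrix} \tilde A & 0 \\ B^y_\Psi\tilde C & A_\Psi \end{bmatrix},\quad\hat B=\begin{bmatrix} \tilde B \\ B^u_\Psi \end{bmatrix},\quad\hat C=\begin{bmatrix} D^y_\Psi\tilde C & C_\Psi \end{bmatrix},\quad\hat D=D^u_\Psi .$$ *Assumption B:* there exist a symmetric $M$ satisfying the truncated hard IQC, $\rho\in(0,1)$, and $\mathbf{P}=\mathbf{P}^\top\succ0$ such that $$\begin{bmatrix} \hat A^\top\mathbf{P}\hat A-\rho^2\mathbf{P} & \hat A^\top\mathbf{P}\hat B \\ \hat B^\top\mathbf{P}\hat A & \hat B^\top\mathbf{P}\hat B \end{bmatrix}+\begin{bmatrix} \hat C^\top \\ \hat D^\top \end{bmatrix}M\begin{bmatrix} \hat C & \hat D \end{bmatrix}\preceq0,$$ and $\mathbf{P}$ has the Kronecker form $\mathbf{P}=P\otimes I_d$ with $P\in\mathbb{R}^{(n+p)\times(n+p)}$. Under these assumptions the projected algorithm has a unique fixed point $x_*$, and $x_*^{(1)}$ is the minimizer of $f$ over $\Omega$. *)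

theory Defs
  imports
    "HOL-Analysis.Analysis"
    "Jordan_Normal_Form.Matrix"
    "Jordan_Normal_Form.Gauss_Jordan_Elimination"
    "Jordan_Normal_Form.Char_Poly"
begin

text \<open>
  The objective lives on \<open>real^'d\<close>, so that \<open>d = CARD('d)\<close>. States, signals and system matrices have
  dimensions such as \<open>(n+p)d\<close> with \<open>p = 0\<close> allowed, and are carrier-based vectors and matrices
  (\<open>Matrix.vec\<close>, \<open>mat\<close>). The two maps below identify \<open>real^'d\<close> with \<open>carrier_vec CARD('d)\<close> by a fixed
  enumeration of the coordinates.
\<close>

definition vec_of :: "real ^ 'd \<Rightarrow> real Matrix.vec" where
  "vec_of x = Matrix.vec CARD('d) (\<lambda>i. vec_nth x (from_nat_into UNIV i))"

definition of_vec :: "real Matrix.vec \<Rightarrow> real ^ 'd" where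
  "of_vec v = (\<chi> j. vec_index v (to_nat_on UNIV j))"

lemma vec_of_carrier [simp]: "vec_of (x :: real ^ 'd) \<in> carrier_vec CARD('d)"
  by (simp add: vec_of_def)

lemma to_nat_on_less_CARD: "to_nat_on (UNIV :: 'd::finite set) j < CARD('d)"
  using bij_betwE[OF to_nat_on_finite[of "UNIV :: 'd set"]] by auto

lemma of_vec_vec_of [simp]: "of_vec (vec_of x) = (x :: real ^ 'd)"
  by (simp add: of_vec_def vec_of_def to_nat_on_less_CARD Finite_Cartesian_Product.vec_eq_iff
      uncountable_def)

lemma vec_of_of_vec:
  assumes "v \<in> carrier_vec CARD('d)"
  shows "vec_of (of_vec v :: real ^ 'd) = v"
proof (rule eq_vecI)
  fix i assume "i < dim_vec v"
  then have i: "i < CARD('d)" using assms by simp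
  then have "i \<in> to_nat_on (UNIV :: 'd set) ` UNIV"
    using to_nat_on_finite[of "UNIV :: 'd set"] by (simp add: bij_betw_def)
  then show "vec_index (vec_of (of_vec v :: real ^ 'd)) i = vec_index v i"
    using i by (simp add: vec_of_def of_vec_def)
qed (use assms in \<open>simp add: vec_of_def\<close>)

definition vnorm :: "real Matrix.vec \<Rightarrow> real" where
  "vnorm x = sqrt (scalar_prod x x)"

definition wnorm :: "real mat \<Rightarrow> real Matrix.vec \<Rightarrow> real" where
  "wnorm P x = sqrt (scalar_prod x (P *\<^sub>v x))"

definition pos_def_mat :: "real mat \<Rightarrow> bool" where
  "pos_def_mat A \<longleftrightarrow> square_mat A \<and> A\<^sup>T = A \<and>
    (\<forall>x \<in> carrier_vec (dim_row A). x \<noteq> 0\<^sub>v (dim_row A) \<longrightarrow> scalar_prod x (A *\<^sub>v x) > 0)"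

definition neg_semidef_mat :: "real mat \<Rightarrow> bool" where
  "neg_semidef_mat A \<longleftrightarrow> square_mat A \<and> A\<^sup>T = A \<and>
    (\<forall>x \<in> carrier_vec (dim_row A). scalar_prod x (A *\<^sub>v x) \<le> 0)"

definition kron :: "real mat \<Rightarrow> real mat \<Rightarrow> real mat" where
  "kron A B = Matrix.mat (dim_row A * dim_row B) (dim_col A * dim_col B)
     (\<lambda>(i, j). A $$ (i div dim_row B, j div dim_col B) * B $$ (i mod dim_row B, j mod dim_col B))"

text \<open>\<open>A\<close> is of the form \<open>A\<^sub>0 \<otimes> I\<^sub>d\<close> with an \<open>r \<times> c\<close> matrix \<open>A\<^sub>0\<close>.\<close>

definition kron_form :: "nat \<Rightarrow> nat \<Rightarrow> nat \<Rightarrow> real mat \<Rightarrow> bool" where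
  "kron_form d r c A \<longleftrightarrow> (\<exists>A0 \<in> carrier_mat r c. A = kron A0 (1\<^sub>m d))"

definition append_cols :: "real mat \<Rightarrow> real mat \<Rightarrow> real mat" where
  "append_cols A B = four_block_mat A B (0\<^sub>m 0 (dim_col A)) (0\<^sub>m 0 (dim_col B))"

definition schur_stable :: "real mat \<Rightarrow> bool" where
  "schur_stable A \<longleftrightarrow>
    (\<forall>z. eigenvalue (map_mat complex_of_real A) z \<longrightarrow> cmod z < 1)"


definition grad :: "(real ^ 'd \<Rightarrow> real) \<Rightarrow> real ^ 'd \<Rightarrow> real ^ 'd" where
  "grad f x = (THE g. GDERIV f x :> g)"

definition S_class :: "real \<Rightarrow> real \<Rightarrow> (real ^ 'd \<Rightarrow> real) set" where
  "S_class m L = {f. (\<forall>x. f differentiable (at x)) \<and>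
     (\<forall>x y. m * (norm (x - y))\<^sup>2 \<le> inner (grad f x - grad f y) (x - y) \<and>
            inner (grad f x - grad f y) (x - y) \<le> L * (norm (x - y))\<^sup>2)}"

definition R_linear :: "(nat \<Rightarrow> real Matrix.vec) \<Rightarrow> real Matrix.vec \<Rightarrow> real \<Rightarrow> bool" where
  "R_linear x xs \<rho> \<longleftrightarrow> (\<exists>c>0. \<forall>k. vnorm (x k - xs) \<le> c * \<rho> ^ k)"

definition wproj :: "real mat \<Rightarrow> real Matrix.vec set \<Rightarrow> real Matrix.vec \<Rightarrow> real Matrix.vec" where
  "wproj P D x = arg_min_on (\<lambda>z. (wnorm P (z - x))\<^sup>2) D"


record algorithm =
  C1 :: "real mat"
  C2 :: "real mat"
  A21 :: "real mat"
  A22 :: "real mat"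

definition algorithm_form :: "nat \<Rightarrow> nat \<Rightarrow> algorithm \<Rightarrow> bool" where
  "algorithm_form d n G \<longleftrightarrow>
     kron_form d 1 1 (C1 G) \<and> kron_form d 1 (n - 1) (C2 G) \<and>
     kron_form d (n - 1) 1 (A21 G) \<and> kron_form d (n - 1) (n - 1) (A22 G)"

definition trafo :: "nat \<Rightarrow> nat \<Rightarrow> algorithm \<Rightarrow> real mat" where
  "trafo d n G = four_block_mat (C1 G) (C2 G) (0\<^sub>m ((n - 1) * d) d) (1\<^sub>m ((n - 1) * d))"

text \<open>The inverse below exists whenever \<open>C1\<close> is invertible; otherwise \<open>the\<close> is unspecified.\<close>

definition A_tilde :: "nat \<Rightarrow> nat \<Rightarrow> algorithm \<Rightarrow> real mat" where
  "A_tilde d n G =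
     trafo d n G * four_block_mat (1\<^sub>m d) (0\<^sub>m d ((n - 1) * d)) (A21 G) (A22 G)
       * the (mat_inverse (trafo d n G))"

definition B_tilde :: "nat \<Rightarrow> nat \<Rightarrow> algorithm \<Rightarrow> real mat" where
  "B_tilde d n G = C1 G @\<^sub>r 0\<^sub>m ((n - 1) * d) d"

definition C_tilde :: "nat \<Rightarrow> nat \<Rightarrow> real mat" where
  "C_tilde d n = append_cols (1\<^sub>m d) (0\<^sub>m d ((n - 1) * d))"


record lin_filter =
  A_Psi :: "real mat"
  By_Psi :: "real mat"
  Bu_Psi :: "real mat"
  C_Psi :: "real mat"
  Dy_Psi :: "real mat"
  Du_Psi :: "real mat"

definition stable_filter :: "nat \<Rightarrow> nat \<Rightarrow> nat \<Rightarrow> lin_filter \<Rightarrow> bool" where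
  "stable_filter d p q F \<longleftrightarrow>
     kron_form d p p (A_Psi F) \<and> kron_form d p 1 (By_Psi F) \<and> kron_form d p 1 (Bu_Psi F) \<and>
     kron_form d q p (C_Psi F) \<and> kron_form d q 1 (Dy_Psi F) \<and> kron_form d q 1 (Du_Psi F) \<and>
     schur_stable (A_Psi F)"

definition filter_next ::
  "lin_filter \<Rightarrow> real Matrix.vec \<Rightarrow> real Matrix.vec \<Rightarrow> real Matrix.vec \<Rightarrow> real Matrix.vec" where
  "filter_next F \<zeta> y u = A_Psi F *\<^sub>v \<zeta> + By_Psi F *\<^sub>v y + Bu_Psi F *\<^sub>v u"

definition filter_out ::
  "lin_filter \<Rightarrow> real Matrix.vec \<Rightarrow> real Matrix.vec \<Rightarrow> real Matrix.vec \<Rightarrow> real Matrix.vec" where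
  "filter_out F \<zeta> y u = C_Psi F *\<^sub>v \<zeta> + Dy_Psi F *\<^sub>v y + Du_Psi F *\<^sub>v u"

primrec filter_state ::
  "lin_filter \<Rightarrow> real Matrix.vec \<Rightarrow> (nat \<Rightarrow> real Matrix.vec) \<Rightarrow> (nat \<Rightarrow> real Matrix.vec) \<Rightarrow> nat
     \<Rightarrow> real Matrix.vec" where
  "filter_state F \<zeta>0 y u 0 = \<zeta>0"
| "filter_state F \<zeta>0 y u (Suc k) = filter_next F (filter_state F \<zeta>0 y u k) (y k) (u k)"

definition filter_fix ::
  "lin_filter \<Rightarrow> real Matrix.vec \<Rightarrow> real Matrix.vec \<Rightarrow> real Matrix.vec" where
  "filter_fix F ys us =
     (THE \<zeta>. \<zeta> \<in> carrier_vec (dim_row (A_Psi F)) \<and> \<zeta> = filter_next F \<zeta> ys us)"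

text \<open>The first argument is the function class over which the constraint is required to hold.\<close>

definition truncated_hard_IQC ::
  "(real ^ 'd \<Rightarrow> real) set \<Rightarrow> lin_filter \<Rightarrow> real mat \<Rightarrow> bool" where
  "truncated_hard_IQC \<F> F M \<longleftrightarrow>
     (\<forall>f \<in> \<F>. \<forall>\<zeta>0 \<in> carrier_vec (dim_row (A_Psi F)). \<forall>y :: nat \<Rightarrow> real ^ 'd. \<forall>ys :: real ^ 'd.
        let yv = (\<lambda>k. vec_of (y k)); uv = (\<lambda>k. vec_of (grad f (y k)));
            ysv = vec_of ys; usv = vec_of (grad f ys);
            h = (\<lambda>k. filter_out F (filter_state F \<zeta>0 yv uv k) (yv k) (uv k));
            hs = filter_out F (filter_fix F ysv usv) ysv usv
        in \<forall>t T. t \<le> T \<longrightarrow> (\<Sum>k = t..T. scalar_prod (h k - hs) (M *\<^sub>v (h k - hs))) \<ge> 0)"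


definition A_hat :: "nat \<Rightarrow> nat \<Rightarrow> nat \<Rightarrow> algorithm \<Rightarrow> lin_filter \<Rightarrow> real mat" where
  "A_hat d n p G F =
     four_block_mat (A_tilde d n G) (0\<^sub>m (n * d) (p * d)) (By_Psi F * C_tilde d n) (A_Psi F)"

definition B_hat :: "nat \<Rightarrow> nat \<Rightarrow> algorithm \<Rightarrow> lin_filter \<Rightarrow> real mat" where
  "B_hat d n G F = B_tilde d n G @\<^sub>r Bu_Psi F"

definition C_hat :: "nat \<Rightarrow> nat \<Rightarrow> lin_filter \<Rightarrow> real mat" where
  "C_hat d n F = append_cols (Dy_Psi F * C_tilde d n) (C_Psi F)"

definition D_hat :: "lin_filter \<Rightarrow> real mat" where
  "D_hat F = Du_Psi F"

definition LMI_mat ::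
  "real mat \<Rightarrow> real mat \<Rightarrow> real mat \<Rightarrow> real mat \<Rightarrow> real mat \<Rightarrow> real mat \<Rightarrow> real \<Rightarrow> real mat" where
  "LMI_mat A B C D P M \<rho> =
     four_block_mat (A\<^sup>T * P * A - \<rho>\<^sup>2 \<cdot>\<^sub>m P) (A\<^sup>T * P * B) (B\<^sup>T * P * A) (B\<^sup>T * P * B)
     + (C\<^sup>T @\<^sub>r D\<^sup>T) * M * append_cols C D"


definition first_block :: "real Matrix.vec \<Rightarrow> real ^ 'd" where
  "first_block x = of_vec (vec_first x CARD('d))"

text \<open>\<open>lift_set N \<Omega>\<close> is \<open>\<Omega> \<times> \<real>\<^sup>N\<close>.\<close>

definition lift_set :: "nat \<Rightarrow> (real ^ 'd) set \<Rightarrow> real Matrix.vec set" where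
  "lift_set N \<Omega> = {vec_of y @\<^sub>v v | y v. y \<in> \<Omega> \<and> v \<in> carrier_vec N}"

definition proj_step ::
  "real mat \<Rightarrow> real mat \<Rightarrow> real mat \<Rightarrow> real Matrix.vec set \<Rightarrow> (real ^ 'd \<Rightarrow> real)
     \<Rightarrow> real Matrix.vec \<Rightarrow> real Matrix.vec" where
  "proj_step A B P D f x = wproj P D (A *\<^sub>v x + B *\<^sub>v vec_of (grad f (first_block x)))"

end

theory Submission
  imports Defs
begin

text \<open>
  Write \<open>T x = A_hat x + B_hat (grad f (x\<^sup>(\<^sup>1\<^sup>)))\<close>. The hard IQC on a single time step, with the filter started at
  an arbitrary state, is a pointwise quadratic inequality, and together with the LMI it makes \<open>T\<close> a
  \<open>\<rho>\<close>-contraction in the \<open>P\<close>-norm. The projection onto a closed convex set is nonexpansive in the same norm, so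
  the projected algorithm is a \<open>\<rho>\<close>-contraction as well and converges to a unique fixed point.

  At the fixed point \<open>x\<close> the vector \<open>T x - x\<close> equals \<open>g \<otimes> \<nu>\<close> up to a positive factor, where
  \<open>P\<^sub>0 g = e\<^sub>1\<close> and \<open>\<nu>\<close> is normal to \<open>\<Omega>\<close> at \<open>x\<^sup>(\<^sup>1\<^sup>)\<close>. The integrator of the algorithm gives a left eigenvector
  \<open>w\<close> of \<open>A_hat\<close> that turns this into \<open>grad f (x\<^sup>(\<^sup>1\<^sup>)) = \<beta> \<nu>\<close>, with \<open>\<beta>\<close> a positive multiple of \<open>w \<bullet> g\<close>.
  Contractivity along the direction \<open>P\<^sub>0\<^sup>-\<^sup>1 w\<close> rules out \<open>\<beta> > 0\<close>, which leaves the first-order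
  optimality condition on \<open>\<Omega>\<close>.
\<close>

unbundle no inner_syntax

section \<open>Weighted inner products on carrier-based vectors\<close>

text \<open>A trivial kernel makes the determinant nonzero, which yields a right inverse. It serves
  \<open>P\<close>, its Kronecker factor and the fixed-point equation of the filter.\<close>

lemma solve_of_trivial_kernel:
  fixes A :: "'a :: field mat"
  assumes A: "A \<in> carrier_mat k k"
    and ker: "\<And>v. v \<in> carrier_vec k \<Longrightarrow> A *\<^sub>v v = 0\<^sub>v k \<Longrightarrow> v = 0\<^sub>v k"
    and b: "b \<in> carrier_vec k"
  obtains x where "x \<in> carrier_vec k" "A *\<^sub>v x = b"
proof -
  have "det A \<noteq> 0"
    using det_0_iff_vec_prod_zero_field[OF A] ker by blast
  from det_non_zero_imp_unit[OF A this, of "()"]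
  obtain B where B: "B \<in> carrier_mat k k" "A * B = 1\<^sub>m k"
    by (auto simp: Units_def ring_mat_def)
  have "A *\<^sub>v (B *\<^sub>v b) = b"
    using A B b by (simp flip: assoc_mult_mat_vec)
  then show ?thesis using that[of "B *\<^sub>v b"] B b by auto
qed

locale weighted_space =
  fixes K :: nat and P :: "real mat"
  assumes P_carrier [simp]: "P \<in> carrier_mat K K" and P_pos_def: "pos_def_mat P"
begin

lemma P_mult_carrier [simp]: "x \<in> carrier_vec K \<Longrightarrow> P *\<^sub>v x \<in> carrier_vec K"
  by (rule mult_mat_vec_carrier[OF P_carrier])

definition ip :: "real Matrix.vec \<Rightarrow> real Matrix.vec \<Rightarrow> real" where
  "ip x y = x \<bullet> (P *\<^sub>v y)"

lemma ip_comm: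
  assumes "x \<in> carrier_vec K" "y \<in> carrier_vec K"
  shows "ip x y = ip y x"
proof -
  have "P\<^sup>T = P" using P_pos_def by (simp add: pos_def_mat_def)
  then have "ip x y = (P *\<^sub>v x) \<bullet> y"
    using transpose_vec_mult_scalar[OF P_carrier assms(2,1)] by (simp add: ip_def)
  also have "\<dots> = ip y x"
    using assms by (simp add: ip_def comm_scalar_prod[of _ K])
  finally show ?thesis .
qed

lemma ip_pos: "x \<in> carrier_vec K \<Longrightarrow> x \<noteq> 0\<^sub>v K \<Longrightarrow> 0 < ip x x"
  using P_pos_def P_carrier unfolding pos_def_mat_def ip_def by auto

lemma ip_zero [simp]: "ip (0\<^sub>v K) (0\<^sub>v K) = 0"
  using scalar_prod_left_zero[OF P_mult_carrier[OF zero_carrier_vec]] by (simp add: ip_def)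

lemma ip_nonneg: "x \<in> carrier_vec K \<Longrightarrow> 0 \<le> ip x x"
  using ip_pos[of x] by (cases "x = 0\<^sub>v K") auto

lemma ip_add_left:
  assumes "x \<in> carrier_vec K" "y \<in> carrier_vec K" "z \<in> carrier_vec K"
  shows "ip (x + y) z = ip x z + ip y z"
  using assms by (simp add: ip_def add_scalar_prod_distrib[of _ K])

lemma ip_minus_left:
  assumes "x \<in> carrier_vec K" "y \<in> carrier_vec K" "z \<in> carrier_vec K"
  shows "ip (x - y) z = ip x z - ip y z"
  using assms by (simp add: ip_def minus_scalar_prod_distrib[of _ K])

lemma ip_smult_left:
  assumes "x \<in> carrier_vec K" "z \<in> carrier_vec K"
  shows "ip (c \<cdot>\<^sub>v x) z = c * ip x z"
  using assms by (simp add: ip_def)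

lemma ip_add_right:
  assumes "x \<in> carrier_vec K" "y \<in> carrier_vec K" "z \<in> carrier_vec K"
  shows "ip z (x + y) = ip z x + ip z y"
  using assms by (simp add: ip_comm[of z] ip_add_left)

lemma ip_minus_right:
  assumes "x \<in> carrier_vec K" "y \<in> carrier_vec K" "z \<in> carrier_vec K"
  shows "ip z (x - y) = ip z x - ip z y"
  using assms by (simp add: ip_comm[of z] ip_minus_left)

lemma ip_smult_right:
  assumes "x \<in> carrier_vec K" "z \<in> carrier_vec K"
  shows "ip z (c \<cdot>\<^sub>v x) = c * ip z x"
  using assms by (simp add: ip_comm[of z] ip_smult_left)

lemmas ip_simps = ip_add_left ip_minus_left ip_smult_left ip_add_right ip_minus_right ip_smult_right

text \<open>\<open>?c x - ?b y\<close> is \<open>?c\<close> times the component of \<open>x\<close>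
  orthogonal to \<open>y\<close>; its nonnegative square is \<open>?c\<close> times the difference
  of the two sides. Working with this multiple avoids a division.\<close>

lemma Cauchy_Schwarz_ip:
  assumes x: "x \<in> carrier_vec K" and y: "y \<in> carrier_vec K"
  shows "(ip x y)\<^sup>2 \<le> ip x x * ip y y"
proof (cases "y = 0\<^sub>v K")
  case True
  then show ?thesis using x ip_minus_right[OF x x x] by simp
next
  case False
  let ?a = "ip x x" and ?b = "ip x y" and ?c = "ip y y"
  have c: "0 < ?c" using ip_pos[OF y False] .
  have "0 \<le> ip (?c \<cdot>\<^sub>v x - ?b \<cdot>\<^sub>v y) (?c \<cdot>\<^sub>v x - ?b \<cdot>\<^sub>v y)"
    using x y by (intro ip_nonneg) simp
  also have "\<dots> = ?c * (?a * ?c - ?b\<^sup>2)"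
    using x y by (simp add: ip_simps ip_comm[of y x] power2_eq_square algebra_simps)
  finally show ?thesis using c by (simp add: zero_le_mult_iff)
qed

lemma wnorm_eq: "wnorm P x = sqrt (ip x x)"
  by (simp add: wnorm_def ip_def)

lemma wnorm_nonneg: "x \<in> carrier_vec K \<Longrightarrow> 0 \<le> wnorm P x"
  by (simp add: wnorm_eq ip_nonneg)

lemma wnorm_sq: "x \<in> carrier_vec K \<Longrightarrow> (wnorm P x)\<^sup>2 = ip x x"
  by (simp add: wnorm_eq ip_nonneg)

lemma wnorm_eq_0: "x \<in> carrier_vec K \<Longrightarrow> wnorm P x = 0 \<longleftrightarrow> x = 0\<^sub>v K"
  using ip_pos[of x] by (cases "x = 0\<^sub>v K") (auto simp: wnorm_eq)

lemma ip_le_wnorm: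
  assumes x: "x \<in> carrier_vec K" and y: "y \<in> carrier_vec K"
  shows "\<bar>ip x y\<bar> \<le> wnorm P x * wnorm P y"
  using Cauchy_Schwarz_ip[OF x y] by (simp add: wnorm_eq real_le_rsqrt flip: real_sqrt_mult)

lemma wnorm_triangle:
  assumes x: "x \<in> carrier_vec K" and y: "y \<in> carrier_vec K"
  shows "wnorm P (x + y) \<le> wnorm P x + wnorm P y"
proof (rule power2_le_imp_le)
  have "(wnorm P (x + y))\<^sup>2 = ip x x + 2 * ip x y + ip y y"
    using x y by (simp add: wnorm_sq ip_simps ip_comm[of y x])
  also have "\<dots> \<le> (wnorm P x + wnorm P y)\<^sup>2"
    using ip_le_wnorm[OF x y] x y by (simp add: power2_sum wnorm_sq)
  finally show "(wnorm P (x + y))\<^sup>2 \<le> (wnorm P x + wnorm P y)\<^sup>2" .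
qed (use x y in \<open>simp add: wnorm_nonneg\<close>)

lemma wnorm_minus_commute:
  assumes x: "x \<in> carrier_vec K" and y: "y \<in> carrier_vec K"
  shows "wnorm P (x - y) = wnorm P (y - x)"
  using x y by (simp add: wnorm_eq ip_simps ip_comm[of y x])

lemma wnorm_triangle_minus:
  assumes "x \<in> carrier_vec K" "y \<in> carrier_vec K" "z \<in> carrier_vec K"
  shows "wnorm P (x - z) \<le> wnorm P (x - y) + wnorm P (y - z)"
proof -
  have "x - z = (x - y) + (y - z)"
    using assms by (intro eq_vecI) auto
  then show ?thesis using wnorm_triangle[of "x - y" "y - z"] assms by simp
qed

section \<open>Linear systems with matrix \<open>P\<close>, and comparison of the weighted norm with
  coordinates and the Euclidean norm\<close>

lemma P_solve:
  assumes "b \<in> carrier_vec K"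
  obtains x where "x \<in> carrier_vec K" "P *\<^sub>v x = b"
proof (rule solve_of_trivial_kernel[OF P_carrier _ assms])
  fix v assume "v \<in> carrier_vec K" "P *\<^sub>v v = 0\<^sub>v K"
  then show "v = 0\<^sub>v K" using ip_pos[of v] by (fastforce simp: ip_def)
qed

text \<open>Coordinate \<open>i\<close> is the functional \<open>ip x (h i)\<close>, where
  \<open>P\<close> maps \<open>h i\<close> to the unit vector \<open>e_i\<close>, so Cauchy-Schwarz
  bounds it.\<close>

lemma coordinate_bound:
  obtains c where "0 < c" "\<And>x i. x \<in> carrier_vec K \<Longrightarrow> i < K \<Longrightarrow> \<bar>vec_index x i\<bar> \<le> c * wnorm P x"
proof -
  have "\<exists>h \<in> carrier_vec K. P *\<^sub>v h = unit_vec K i" for i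
    using P_solve[of "unit_vec K i"] by auto
  then obtain h where h: "\<And>i. h i \<in> carrier_vec K" "\<And>i. P *\<^sub>v h i = unit_vec K i"
    by metis
  \<comment> \<open>The sum gives one constant for all coordinates; the added 1 keeps it positive
    even for \<open>K = 0\<close>.\<close>
  define c where "c = (\<Sum>i<K. wnorm P (h i)) + 1"
  have nn: "0 \<le> (\<Sum>i<K. wnorm P (h i))"
    using h by (intro sum_nonneg wnorm_nonneg)
  have "\<bar>vec_index x i\<bar> \<le> c * wnorm P x" if x: "x \<in> carrier_vec K" and i: "i < K" for x i
  proof -
    have "vec_index x i = ip x (h i)"
      using x i by (simp add: ip_def h scalar_prod_right_unit)
    then have "\<bar>vec_index x i\<bar> \<le> wnorm P (h i) * wnorm P x"
      using ip_le_wnorm[OF x h(1)[of i]] by (simp add: mult.commute)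
    also have "wnorm P (h i) \<le> (\<Sum>i<K. wnorm P (h i))"
      using i h by (intro member_le_sum) (auto intro: wnorm_nonneg)
    then have "wnorm P (h i) * wnorm P x \<le> c * wnorm P x"
      using wnorm_nonneg[OF x] by (intro mult_right_mono) (simp_all add: c_def)
    finally show ?thesis .
  qed
  then show ?thesis using that[of c] nn by (simp add: c_def)
qed

text \<open>This transfers the rate from the weighted norm to the Euclidean norm of
  \<open>R_linear\<close>. The factor \<open>sqrt K\<close> comes from adding \<open>K\<close>
  squared coordinate bounds; the 1 again secures positivity for \<open>K = 0\<close>.\<close>

lemma vnorm_le_wnorm:
  obtains c where "0 < c" "\<And>x. x \<in> carrier_vec K \<Longrightarrow> vnorm x \<le> c * wnorm P x"
proof -
  obtain c where c: "0 < c"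
    "\<And>x i. x \<in> carrier_vec K \<Longrightarrow> i < K \<Longrightarrow> \<bar>vec_index x i\<bar> \<le> c * wnorm P x"
    using coordinate_bound by blast
  have "vnorm x \<le> (sqrt (real K) * c + 1) * wnorm P x" if x: "x \<in> carrier_vec K" for x
  proof -
    have "x \<bullet> x = (\<Sum>i = 0..<K. \<bar>vec_index x i\<bar>\<^sup>2)"
      using x by (simp add: scalar_prod_def power2_eq_square)
    also have "\<dots> \<le> (\<Sum>i = 0..<K. (c * wnorm P x)\<^sup>2)"
      using c(2)[OF x] by (intro sum_mono power_mono) auto
    finally have "x \<bullet> x \<le> real K * (c * wnorm P x)\<^sup>2" by simp
    then have "vnorm x \<le> sqrt (real K * (c * wnorm P x)\<^sup>2)"
      by (simp add: vnorm_def)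
    also have "\<dots> = sqrt (real K) * c * wnorm P x"
      using c(1) wnorm_nonneg[OF x] by (simp add: real_sqrt_mult)
    also have "\<dots> \<le> (sqrt (real K) * c + 1) * wnorm P x"
      using wnorm_nonneg[OF x] by (simp add: algebra_simps)
    finally show ?thesis .
  qed
  moreover have "0 < sqrt (real K) * c + 1"
    using c(1) by (simp add: add_nonneg_pos)
  ultimately show ?thesis using that by blast
qed

text \<open>The quadratic form is a polynomial in finitely many coordinates, so coordinatewise
  limits pass through it.\<close>

lemma wnorm_tendsto_0:
  assumes x: "\<And>k. x k \<in> carrier_vec K"
    and lim: "\<And>i. i < K \<Longrightarrow> (\<lambda>k :: nat. vec_index (x k) i) \<longlonglongrightarrow> 0"
  shows "(\<lambda>k. wnorm P (x k)) \<longlonglongrightarrow> 0"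
proof -
  have "ip (x k) (x k) =
      (\<Sum>i = 0..<K. vec_index (x k) i * (\<Sum>j = 0..<K. P $$ (i, j) * vec_index (x k) j))" for k
    using x[of k] carrier_matD[OF P_carrier] by (simp add: ip_def scalar_prod_def)
  moreover have "(\<lambda>k. \<Sum>i = 0..<K. vec_index (x k) i * (\<Sum>j = 0..<K. P $$ (i, j) * vec_index (x k) j))
      \<longlonglongrightarrow> (\<Sum>i = 0..<K. 0 * (\<Sum>j = 0..<K. P $$ (i, j) * 0))"
    by (intro tendsto_intros lim) auto
  ultimately have "(\<lambda>k. ip (x k) (x k)) \<longlonglongrightarrow> 0" by simp
  from tendsto_real_sqrt[OF this] show ?thesis by (simp add: wnorm_eq)
qed

section \<open>Contractions in the weighted norm\<close>

lemma contraction_iterates: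
  assumes S: "\<And>x. x \<in> carrier_vec K \<Longrightarrow> S x \<in> carrier_vec K"
    and contr: "\<And>x y. x \<in> carrier_vec K \<Longrightarrow> y \<in> carrier_vec K \<Longrightarrow>
      wnorm P (S x - S y) \<le> \<rho> * wnorm P (x - y)"
    and \<rho>: "0 \<le> \<rho>" and x: "x \<in> carrier_vec K" and y: "y \<in> carrier_vec K"
  shows "(S ^^ k) x \<in> carrier_vec K"
    and "wnorm P ((S ^^ k) x - (S ^^ k) y) \<le> \<rho> ^ k * wnorm P (x - y)"
proof -
  have car: "(S ^^ k) x \<in> carrier_vec K" if "x \<in> carrier_vec K" for k x
    by (induction k) (use that S in auto)
  show "(S ^^ k) x \<in> carrier_vec K" using car x .
  show "wnorm P ((S ^^ k) x - (S ^^ k) y) \<le> \<rho> ^ k * wnorm P (x - y)"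
  proof (induction k)
    case (Suc k)
    have "wnorm P ((S ^^ Suc k) x - (S ^^ Suc k) y) \<le> \<rho> * wnorm P ((S ^^ k) x - (S ^^ k) y)"
      using contr car x y by simp
    also have "\<dots> \<le> \<rho> * (\<rho> ^ k * wnorm P (x - y))"
      using Suc \<rho> by (rule mult_left_mono)
    finally show ?case by simp
  qed simp
qed

text \<open>Banach's argument, carried out coordinatewise on the carrier set: along the orbit of the
  zero vector the increments of every coordinate are dominated by a geometric series, so each
  coordinate converges, and the vector of the limits is the fixed point.\<close>

lemma contraction_fixed_point:
  assumes S: "\<And>x. x \<in> carrier_vec K \<Longrightarrow> S x \<in> carrier_vec K"
    and contr: "\<And>x y. x \<in> carrier_vec K \<Longrightarrow> y \<in> carrier_vec K \<Longrightarrow>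
      wnorm P (S x - S y) \<le> \<rho> * wnorm P (x - y)"
    and \<rho>: "0 \<le> \<rho>" "\<rho> < 1"
  obtains xs where "xs \<in> carrier_vec K" "S xs = xs"
proof -
  obtain c where c: "0 < c"
    "\<And>x i. x \<in> carrier_vec K \<Longrightarrow> i < K \<Longrightarrow> \<bar>vec_index x i\<bar> \<le> c * wnorm P x"
    using coordinate_bound by blast
  define X where "X k = (S ^^ k) (0\<^sub>v K)" for k
  have X: "X k \<in> carrier_vec K" for k
    unfolding X_def by (rule contraction_iterates(1)[OF S contr \<rho>(1) zero_carrier_vec zero_carrier_vec])
  define w where "w = wnorm P (X 1 - X 0)"
  have step: "wnorm P (X (Suc k) - X k) \<le> \<rho> ^ k * w" for k
    using contraction_iterates(2)[OF S contr \<rho>(1) X[of 1] X[of 0], of k]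
    by (simp add: X_def w_def funpow_swap1)
  have conv: "convergent (\<lambda>k. vec_index (X k) i)" if i: "i < K" for i
  proof -
    have "summable (\<lambda>k. vec_index (X (Suc k)) i - vec_index (X k) i)"
    proof (rule summable_comparison_test)
      show "summable (\<lambda>k. c * w * \<rho> ^ k)"
        using \<rho> by (intro summable_mult summable_geometric) simp
      have "norm (vec_index (X (Suc k)) i - vec_index (X k) i) \<le> c * w * \<rho> ^ k" for k
      proof -
        have "\<bar>vec_index (X (Suc k) - X k) i\<bar> \<le> c * wnorm P (X (Suc k) - X k)"
          using c(2) i X by simp
        also have "\<dots> \<le> c * (\<rho> ^ k * w)"
          using step c(1) by (intro mult_left_mono) auto
        finally show ?thesis using i X[of k] X[of "Suc k"] by (simp add: mult_ac)
      qed
      then show "\<exists>N. \<forall>k\<ge>N. norm (vec_index (X (Suc k)) i - vec_index (X k) i) \<le> c * w * \<rho> ^ k"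
        by blast
    qed
    then have "convergent (\<lambda>n. \<Sum>k<n. vec_index (X (Suc k)) i - vec_index (X k) i)"
      by (simp add: summable_iff_convergent)
    moreover have "(\<lambda>n. \<Sum>k<n. vec_index (X (Suc k)) i - vec_index (X k) i)
        = (\<lambda>n. vec_index (X n) i - vec_index (X 0) i)"
      using sum_lessThan_telescope[of "\<lambda>k. vec_index (X k) i"] by auto
    ultimately show ?thesis by (simp add: convergent_diff_const_right_iff)
  qed
  define xs where "xs = Matrix.vec K (\<lambda>i. lim (\<lambda>k. vec_index (X k) i))"
  have xs: "xs \<in> carrier_vec K" by (simp add: xs_def)
  have "(\<lambda>k. vec_index (X k - xs) i) \<longlonglongrightarrow> 0" if i: "i < K" for i
  proof -
    have "(\<lambda>k. vec_index (X k) i) \<longlonglongrightarrow> vec_index xs i"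
      using conv[OF i] i by (simp add: convergent_LIMSEQ_iff xs_def)
    then have "(\<lambda>k. vec_index (X k) i - vec_index xs i) \<longlonglongrightarrow> 0"
      by (simp add: LIM_zero)
    then show ?thesis using i X xs by simp
  qed
  then have lim: "(\<lambda>k. wnorm P (X k - xs)) \<longlonglongrightarrow> 0"
    using X xs by (intro wnorm_tendsto_0) auto
  \<comment> \<open>Inserting \<open>S (X k) = X (Suc k)\<close> between \<open>S xs\<close> and
    \<open>xs\<close> bounds the defect of \<open>xs\<close> by two quantities that vanish as
    \<open>k\<close> grows.\<close>
  have bound: "wnorm P (S xs - xs) \<le> \<rho> * wnorm P (X k - xs) + wnorm P (X (Suc k) - xs)" for k
  proof -
    have "X (Suc k) = S (X k)" by (simp add: X_def)
    then have "wnorm P (S xs - xs) \<le> wnorm P (S xs - S (X k)) + wnorm P (X (Suc k) - xs)"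
      using wnorm_triangle_minus[OF S[OF xs] S[OF X] xs] by simp
    also have "wnorm P (S xs - S (X k)) \<le> \<rho> * wnorm P (X k - xs)"
      using contr[OF xs X, of k] wnorm_minus_commute[OF xs X, of k] by simp
    finally show ?thesis by simp
  qed
  have "(\<lambda>k. \<rho> * wnorm P (X k - xs) + wnorm P (X (Suc k) - xs)) \<longlonglongrightarrow> \<rho> * 0 + 0"
    by (intro tendsto_intros lim LIMSEQ_Suc)
  then have "wnorm P (S xs - xs) \<le> 0"
    using bound by (intro LIMSEQ_le_const[of _ 0]) auto
  then have "S xs - xs = 0\<^sub>v K"
    using wnorm_eq_0[of "S xs - xs"] wnorm_nonneg[of "S xs - xs"] S xs by auto
  have "S xs = xs"
  proof (rule eq_vecI)
    fix i assume i: "i < dim_vec xs"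
    then have "vec_index (S xs - xs) i = 0"
      using \<open>S xs - xs = 0\<^sub>v K\<close> xs by simp
    then show "vec_index (S xs) i = vec_index xs i" using i by simp
  qed (use S[OF xs] xs in simp)
  then show ?thesis using that xs by blast
qed

end

section \<open>Kronecker structure and gradients\<close>

text \<open>The Kronecker product of two vectors, with entries numbered by \<open>div\<close> and
  \<open>mod\<close> exactly as in \<open>kron\<close>.\<close>

definition tens :: "real Matrix.vec \<Rightarrow> real Matrix.vec \<Rightarrow> real Matrix.vec" where
  "tens a v = Matrix.vec (dim_vec a * dim_vec v)
     (\<lambda>i. vec_index a (i div dim_vec v) * vec_index v (i mod dim_vec v))"

lemma tens_carrier [simp]:
  "a \<in> carrier_vec N \<Longrightarrow> v \<in> carrier_vec d \<Longrightarrow> tens a v \<in> carrier_vec (N * d)"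
  by (intro carrier_vecI) (simp add: tens_def)

text \<open>The index is split into the number of a block and the position inside it, as
  \<open>kron\<close> and \<open>tens\<close> address their entries.\<close>

lemma sum_times_div_mod:
  fixes g :: "nat \<Rightarrow> 'a :: comm_monoid_add"
  shows "(\<Sum>i = 0..<N * d. g i) = (\<Sum>i = 0..<N. \<Sum>j = 0..<d. g (i * d + j))"
proof (induction N)
  case (Suc N)
  have "(\<Sum>i = 0..<Suc N * d. g i) = (\<Sum>i = 0..<N * d. g i) + (\<Sum>i = N * d..<N * d + d. g i)"
    by (simp add: sum.atLeastLessThan_concat add.commute)
  also have "(\<Sum>i = N * d..<N * d + d. g i) = (\<Sum>j = 0..<d. g (N * d + j))"
    using sum.shift_bounds_nat_ivl[of g 0 "N * d" d] by (simp add: add.commute)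
  finally show ?case using Suc by simp
qed simp

lemma tens_scalar_prod:
  assumes "a \<in> carrier_vec N" "b \<in> carrier_vec N" "v \<in> carrier_vec d" "w \<in> carrier_vec d"
  shows "tens a v \<bullet> tens b w = (a \<bullet> b) * (v \<bullet> w)"
proof -
  have "tens a v \<bullet> tens b w =
      (\<Sum>i = 0..<N * d. (vec_index a (i div d) * vec_index v (i mod d)) *
        (vec_index b (i div d) * vec_index w (i mod d)))"
    using assms by (simp add: scalar_prod_def tens_def)
  also have "\<dots> = (\<Sum>i = 0..<N. \<Sum>j = 0..<d. (vec_index a i * vec_index v j) *
        (vec_index b i * vec_index w j))"
    unfolding sum_times_div_mod by (intro sum.cong refl) auto
  also have "\<dots> = (a \<bullet> b) * (v \<bullet> w)"
    using assms by (simp add: scalar_prod_def sum_product mult_ac)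
  finally show ?thesis .
qed

lemma kron_carrier [simp]:
  "A \<in> carrier_mat r c \<Longrightarrow> B \<in> carrier_mat r' c' \<Longrightarrow> kron A B \<in> carrier_mat (r * r') (c * c')"
  by (intro carrier_matI) (simp_all add: kron_def)

text \<open>This is the mixed-product rule with an identity factor: in the sum over positions inside
  a block the identity leaves only the term \<open>l = i mod d\<close>.\<close>

lemma kron_mult_tens:
  assumes A: "A \<in> carrier_mat r N" and a: "a \<in> carrier_vec N" and v: "v \<in> carrier_vec d"
  shows "kron A (1\<^sub>m d) *\<^sub>v tens a v = tens (A *\<^sub>v a) v"
proof (rule eq_vecI)
  fix i assume "i < dim_vec (tens (A *\<^sub>v a) v)"
  then have i: "i < r * d" using A v by (simp add: tens_def)
  then have d: "0 < d" and idiv: "i div d < r" by (auto simp: less_mult_imp_div_less intro: gr0I)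
  have "vec_index (kron A (1\<^sub>m d) *\<^sub>v tens a v) i =
      (\<Sum>j = 0..<N * d. A $$ (i div d, j div d) * (1\<^sub>m d $$ (i mod d, j mod d)) *
        (vec_index a (j div d) * vec_index v (j mod d)))"
    using A a v i by (simp add: kron_def tens_def scalar_prod_def)
  also have "\<dots> = (\<Sum>k = 0..<N. \<Sum>l = 0..<d. A $$ (i div d, k) * (1\<^sub>m d $$ (i mod d, l)) *
        (vec_index a k * vec_index v l))"
    unfolding sum_times_div_mod by (intro sum.cong refl) auto
  also have "\<dots> = (\<Sum>k = 0..<N. \<Sum>l = 0..<d.
      if l = i mod d then A $$ (i div d, k) * vec_index a k * vec_index v l else 0)"
    using d by (intro sum.cong refl) auto
  also have "\<dots> = (\<Sum>k = 0..<N. A $$ (i div d, k) * vec_index a k * vec_index v (i mod d))"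
    using d by (simp add: sum.delta)
  also have "\<dots> = vec_index (tens (A *\<^sub>v a) v) i"
    using A a v i idiv by (simp add: tens_def scalar_prod_def sum_distrib_right)
  finally show "vec_index (kron A (1\<^sub>m d) *\<^sub>v tens a v) i = vec_index (tens (A *\<^sub>v a) v) i" .
qed (use A v in \<open>simp add: kron_def tens_def\<close>)

lemma transpose_kron: "(kron A B)\<^sup>T = kron A\<^sup>T B\<^sup>T"
proof (rule eq_matI)
  fix i j assume "i < dim_row (kron A\<^sup>T B\<^sup>T)" "j < dim_col (kron A\<^sup>T B\<^sup>T)"
  then have ij: "i < dim_col A * dim_col B" "j < dim_row A * dim_row B"
    by (simp_all add: kron_def)
  then have pos: "0 < dim_col B" "0 < dim_row B"
    by (auto intro: gr0I)
  then show "(kron A B)\<^sup>T $$ (i, j) = kron A\<^sup>T B\<^sup>T $$ (i, j)"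
    using ij by (simp add: kron_def less_mult_imp_div_less)
qed (simp_all add: kron_def)

text \<open>In the \<open>div\<close>/\<open>mod\<close> numbering block 0 consists of the first
  \<open>d\<close> entries; this is how the first block of a state enters the Kronecker
  calculus.\<close>

lemma tens_unit:
  assumes N: "0 < N" and v: "v \<in> carrier_vec d"
  shows "tens (unit_vec N 0) v = v @\<^sub>v 0\<^sub>v ((N - 1) * d)"
proof (rule eq_vecI)
  have Nd: "N * d = d + (N - 1) * d" using N by (cases N) auto
  show "dim_vec (tens (unit_vec N 0) v) = dim_vec (v @\<^sub>v 0\<^sub>v ((N - 1) * d))"
    using v Nd by (simp add: tens_def)
  fix i assume "i < dim_vec (v @\<^sub>v 0\<^sub>v ((N - 1) * d))"
  then have i: "i < N * d" using v Nd by simp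
  then have d: "0 < d" and idiv: "i div d < N" by (auto simp: less_mult_imp_div_less intro: gr0I)
  show "vec_index (tens (unit_vec N 0) v) i = vec_index (v @\<^sub>v 0\<^sub>v ((N - 1) * d)) i"
  proof (cases "i < d")
    case True
    then show ?thesis using v i idiv N Nd by (simp add: tens_def)
  next
    case False
    then have "i div d \<noteq> 0" using d by (simp add: div_eq_0_iff)
    then show ?thesis using v i idiv N Nd False by (simp add: tens_def)
  qed
qed

lemma vec_first_tens:
  assumes "a \<in> carrier_vec N" "0 < N" "v \<in> carrier_vec d"
  shows "vec_first (tens a v) d = vec_index a 0 \<cdot>\<^sub>v v"
proof (rule eq_vecI)
  fix i assume "i < dim_vec (vec_index a 0 \<cdot>\<^sub>v v)"
  then have i: "i < d" using assms by simp
  moreover have "d \<le> N * d" using assms by simp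
  ultimately have "i < N * d" by linarith
  then show "vec_index (vec_first (tens a v) d) i = vec_index (vec_index a 0 \<cdot>\<^sub>v v) i"
    using assms i by (simp add: vec_first_def tens_def)
qed (use assms in simp)

lemma append_zero_scalar_prod:
  assumes "v \<in> carrier_vec d" "x \<in> carrier_vec (d + k)"
  shows "(v @\<^sub>v 0\<^sub>v k) \<bullet> x = v \<bullet> vec_first x d"
proof -
  have "(v @\<^sub>v 0\<^sub>v k) \<bullet> (vec_first x d @\<^sub>v vec_last x k) = v \<bullet> vec_first x d"
    using assms by (subst scalar_prod_append[of _ d _ k]) auto
  then show ?thesis using assms by simp
qed

lemma vec_first_plus:
  assumes "x \<in> carrier_vec (d + k)" "y \<in> carrier_vec (d + k)"
  shows "vec_first (x + y) d = vec_first x d + vec_first y d"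
  using assms by (intro eq_vecI) (auto simp: vec_first_def)

lemma vec_first_minus:
  assumes "x \<in> carrier_vec (d + k)" "y \<in> carrier_vec (d + k)"
  shows "vec_first (x - y) d = vec_first x d - vec_first y d"
  using assms by (intro eq_vecI) (auto simp: vec_first_def)

section \<open>The space of the objective as carrier vectors, and the first block of a state\<close>

lemma vec_of_diff: "vec_of (x - y :: real ^ 'd) = vec_of x - vec_of y"
  by (rule eq_vecI) (simp_all add: vec_of_def)

lemma vec_of_scaleR: "vec_of (c *\<^sub>R x :: real ^ 'd) = c \<cdot>\<^sub>v vec_of x"
  by (rule eq_vecI) (simp_all add: vec_of_def)

lemma vec_of_inject: "vec_of (x :: real ^ 'd) = vec_of y \<longleftrightarrow> x = y"
  by (metis of_vec_vec_of)

text \<open>The enumeration of the coordinates is a bijection, so reindexing the sum shows that the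
  identification is isometric.\<close>

lemma vec_of_scalar_prod: "vec_of x \<bullet> vec_of y = inner x (y :: real ^ 'd)"
proof -
  have "vec_of x \<bullet> vec_of y =
      (\<Sum>i = 0..<CARD('d). vec_nth x (from_nat_into UNIV i) * vec_nth y (from_nat_into UNIV i))"
    by (simp add: scalar_prod_def vec_of_def)
  also have "\<dots> = (\<Sum>j \<in> UNIV. vec_nth x j * vec_nth y j)"
    using bij_betw_from_nat_into_finite[of "UNIV :: 'd set"]
    by (intro sum.reindex_bij_betw) (simp add: atLeast0LessThan)
  finally show ?thesis by (simp add: inner_vec_def)
qed

lemma vec_of_first_block: "vec_of (first_block x :: real ^ 'd) = vec_first x CARD('d)"
  by (simp add: first_block_def vec_of_of_vec)

lemma first_block_append:
  "first_block (vec_of y @\<^sub>v v) = (y :: real ^ 'd)"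
proof -
  have "vec_first (vec_of y @\<^sub>v v) CARD('d) = vec_of y"
    by (rule eq_vecI) (simp_all add: vec_first_def vec_of_def)
  then show ?thesis by (simp add: first_block_def)
qed

lemma lift_set_iff:
  fixes \<Omega> :: "(real ^ 'd) set"
  shows "x \<in> lift_set k \<Omega> \<longleftrightarrow> x \<in> carrier_vec (CARD('d) + k) \<and> first_block x \<in> \<Omega>"
proof
  assume "x \<in> lift_set k \<Omega>"
  then show "x \<in> carrier_vec (CARD('d) + k) \<and> first_block x \<in> \<Omega>"
    by (auto simp: lift_set_def first_block_append)
next
  assume x: "x \<in> carrier_vec (CARD('d) + k) \<and> first_block x \<in> \<Omega>"
  then have "x = vec_of (first_block x :: real ^ 'd) @\<^sub>v vec_last x k"
    by (simp add: vec_of_first_block)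
  then show "x \<in> lift_set k \<Omega>"
    using x unfolding lift_set_def by (metis (mono_tags, lifting) mem_Collect_eq vec_last_carrier)
qed

text \<open>\<open>grad\<close> is a definite description, so both existence and uniqueness are due.
  The gradient is the Riesz vector of the derivative, built on the standard basis, and uniqueness of
  the derivative determines it.\<close>

lemma GDERIV_grad:
  fixes f :: "real ^ 'd \<Rightarrow> real"
  assumes "f differentiable (at x)"
  shows "GDERIV f x :> grad f x"
proof -
  from assms obtain D where D: "(f has_derivative D) (at x)"
    by (auto simp: differentiable_def)
  then have lin: "linear D" by (rule has_derivative_linear)
  define g where "g = (\<Sum>b\<in>Basis. D b *\<^sub>R b)"
  have "D = (\<lambda>h. inner h g)"
  proof
    fix h
    have "D h = D (\<Sum>b\<in>Basis. inner h b *\<^sub>R b)" by (simp add: euclidean_representation)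
    also have "\<dots> = (\<Sum>b\<in>Basis. inner h b * D b)"
      using lin by (simp add: linear_sum linear_cmul)
    also have "\<dots> = inner h g" by (simp add: g_def inner_sum_right mult.commute)
    finally show "D h = inner h g" .
  qed
  then have g: "GDERIV f x :> g" using D by (simp add: gderiv_def)
  have "g' = g" if "GDERIV f x :> g'" for g'
  proof -
    have "(\<lambda>h. inner h g') = (\<lambda>h. inner h g)"
      using that g unfolding gderiv_def by (rule has_derivative_unique)
    then have "inner (g' - g) (g' - g) = 0" by (simp add: inner_diff_right fun_eq_iff)
    then show ?thesis by simp
  qed
  then show ?thesis unfolding grad_def using g by (metis theI)
qed

text \<open>The mean value theorem on the segment from \<open>x\<close> to \<open>z\<close> replaces
  \<open>f z - f x\<close> by the slope at an interior point, and strong monotonicity makes that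
  slope strictly larger than the slope at \<open>x\<close>. Strictness later gives uniqueness of the
  minimizer.\<close>

lemma S_class_strict_tangent:
  fixes f :: "real ^ 'd \<Rightarrow> real"
  assumes f: "f \<in> S_class m L" and m: "0 < m" and ne: "z \<noteq> x"
  shows "f x + inner (grad f x) (z - x) < f z"
proof -
  define \<phi> where "\<phi> t = f (x + t *\<^sub>R (z - x))" for t :: real
  have deriv: "(\<phi> has_real_derivative inner (grad f (x + t *\<^sub>R (z - x))) (z - x)) (at t)" for t
  proof -
    have "GDERIV f (x + t *\<^sub>R (z - x)) :> grad f (x + t *\<^sub>R (z - x))"
      using f by (intro GDERIV_grad) (auto simp: S_class_def)
    then have "(f has_derivative (\<lambda>h. inner h (grad f (x + t *\<^sub>R (z - x))))) (at (x + t *\<^sub>R (z - x)))"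
      by (simp add: gderiv_def)
    moreover have "((\<lambda>t. x + t *\<^sub>R (z - x)) has_derivative (\<lambda>h. h *\<^sub>R (z - x))) (at t)"
      by (auto intro!: derivative_eq_intros)
    ultimately have "(\<phi> has_derivative (\<lambda>h. inner (h *\<^sub>R (z - x)) (grad f (x + t *\<^sub>R (z - x))))) (at t)"
      unfolding \<phi>_def using has_derivative_compose by blast
    then show ?thesis
      by (simp add: has_field_derivative_def inner_commute mult_commute_abs)
  qed
  obtain t where t: "0 < t" "t < 1"
    and eq: "\<phi> 1 - \<phi> 0 = (1 - 0) * inner (grad f (x + t *\<^sub>R (z - x))) (z - x)"
    using MVT2[of 0 1 \<phi> "\<lambda>t. inner (grad f (x + t *\<^sub>R (z - x))) (z - x)"] deriv by auto
  let ?y = "x + t *\<^sub>R (z - x)"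
  have "m * (norm (?y - x))\<^sup>2 \<le> inner (grad f ?y - grad f x) (?y - x)"
    using f unfolding S_class_def by blast
  moreover have "0 < m * (norm (?y - x))\<^sup>2" using m ne t by simp
  ultimately have "0 < t * inner (grad f ?y - grad f x) (z - x)" by simp
  then have "0 < inner (grad f ?y - grad f x) (z - x)" using t by (simp add: zero_less_mult_iff)
  moreover have "f z - f x = inner (grad f ?y) (z - x)" using eq by (simp add: \<phi>_def)
  ultimately show ?thesis by (simp add: inner_diff_left)
qed

section \<open>The linear matrix inequality and the quadratic constraint\<close>

lemma kron_form_carrier: "kron_form d r c A \<Longrightarrow> A \<in> carrier_mat (r * d) (c * d)"
  by (auto simp: kron_form_def)

lemma scalar_prod_transpose_mult:
  fixes A :: "real mat"
  assumes "A \<in> carrier_mat r c" "x \<in> carrier_vec c" "y \<in> carrier_vec r"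
  shows "x \<bullet> (A\<^sup>T *\<^sub>v y) = (A *\<^sub>v x) \<bullet> y"
  using transpose_vec_mult_scalar[OF assms] assms
  by (simp add: comm_scalar_prod[of x c] comm_scalar_prod[of y r])

lemma smult_mat_mult_vec:
  assumes "A \<in> carrier_mat r c" "x \<in> carrier_vec c"
  shows "(s \<cdot>\<^sub>m A) *\<^sub>v x = s \<cdot>\<^sub>v (A *\<^sub>v x)"
  by (intro eq_vecI) (simp_all add: carrier_vecD[OF assms(2)] carrier_matD[OF assms(1)]
      scalar_prod_def sum_distrib_left mult.assoc)

lemma diff_vec_eq_iff:
  fixes a b c :: "real Matrix.vec"
  assumes "a \<in> carrier_vec k" "b \<in> carrier_vec k" "c \<in> carrier_vec k"
  shows "a - b = c \<longleftrightarrow> a = b + c"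
  using assms by (auto simp: vec_eq_iff)

lemma append_cols_carrier [simp]:
  "A \<in> carrier_mat r c1 \<Longrightarrow> B \<in> carrier_mat r c2 \<Longrightarrow> append_cols A B \<in> carrier_mat r (c1 + c2)"
  unfolding append_cols_def carrier_mat_def by simp

lemma append_cols_mult_vec:
  assumes A: "A \<in> carrier_mat r c1" and B: "B \<in> carrier_mat r c2"
    and x: "x \<in> carrier_vec c1" and y: "y \<in> carrier_vec c2"
  shows "append_cols A B *\<^sub>v (x @\<^sub>v y) = A *\<^sub>v x + B *\<^sub>v y"
proof -
  have "append_cols A B *\<^sub>v (x @\<^sub>v y) =
      (A *\<^sub>v x + B *\<^sub>v y) @\<^sub>v (0\<^sub>m 0 c1 *\<^sub>v x + 0\<^sub>m 0 c2 *\<^sub>v y)"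
    unfolding append_cols_def carrier_matD(2)[OF A] carrier_matD(2)[OF B]
    by (rule four_block_mat_mult_vec[OF A B _ _ x y]) auto
  also have "\<dots> = A *\<^sub>v x + B *\<^sub>v y"
    by (rule eq_vecI) auto
  finally show ?thesis .
qed

text \<open>The dissipation inequality encoded by the matrix: evaluate it at the stacked vector
  \<open>(x, u)\<close> and move every transposed factor to the other side of the scalar product. It
  is applied later to differences of two states and of their gradients.\<close>

lemma LMI_quadratic_form:
  assumes A: "A \<in> carrier_mat K K" and B: "B \<in> carrier_mat K k"
    and C: "C \<in> carrier_mat r K" and D: "D \<in> carrier_mat r k"
    and P: "P \<in> carrier_mat K K" and M: "M \<in> carrier_mat r r"
    and nsd: "neg_semidef_mat (LMI_mat A B C D P M \<rho>)"
    and x: "x \<in> carrier_vec K" and u: "u \<in> carrier_vec k"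
  shows "(A *\<^sub>v x + B *\<^sub>v u) \<bullet> (P *\<^sub>v (A *\<^sub>v x + B *\<^sub>v u)) + (C *\<^sub>v x + D *\<^sub>v u) \<bullet> (M *\<^sub>v (C *\<^sub>v x + D *\<^sub>v u))
    \<le> \<rho>\<^sup>2 * (x \<bullet> (P *\<^sub>v x))"
proof -
  define a b h where "a = A *\<^sub>v x" and "b = B *\<^sub>v u" and "h = C *\<^sub>v x + D *\<^sub>v u"
  have abh: "a \<in> carrier_vec K" "b \<in> carrier_vec K" "h \<in> carrier_vec r"
    using A B C D x u by (auto simp: a_def b_def h_def intro!: add_carrier_vec mult_mat_vec_carrier)
  define Pa Pb Mh where "Pa = P *\<^sub>v a" and "Pb = P *\<^sub>v b" and "Mh = M *\<^sub>v h"
  have Pab: "Pa \<in> carrier_vec K" "Pb \<in> carrier_vec K" "Mh \<in> carrier_vec r" "P *\<^sub>v x \<in> carrier_vec K"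
    using abh P M x by (auto simp: Pa_def Pb_def Mh_def)
  \<comment> \<open>\<open>X\<close> carries the change of the weighted norm and \<open>Y\<close>
    the quadratic form of the output; both are evaluated separately at
    \<open>(x, u)\<close>.\<close>
  define X where
    "X = four_block_mat (A\<^sup>T * P * A - \<rho>\<^sup>2 \<cdot>\<^sub>m P) (A\<^sup>T * P * B) (B\<^sup>T * P * A) (B\<^sup>T * P * B)"
  define Y where "Y = (C\<^sup>T @\<^sub>r D\<^sup>T) * M * append_cols C D"
  have X: "X \<in> carrier_mat (K + k) (K + k)" unfolding X_def using A B P by auto
  have CD: "C\<^sup>T @\<^sub>r D\<^sup>T \<in> carrier_mat (K + k) r" "append_cols C D \<in> carrier_mat r (K + k)"
    using C D by auto
  then have Y: "Y \<in> carrier_mat (K + k) (K + k)" unfolding Y_def using M by auto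
  have eq: "LMI_mat A B C D P M \<rho> = X + Y" by (simp add: LMI_mat_def X_def Y_def)
  have z: "x @\<^sub>v u \<in> carrier_vec (K + k)" using x u by simp
  have "X *\<^sub>v (x @\<^sub>v u) =
      ((A\<^sup>T * P * A - \<rho>\<^sup>2 \<cdot>\<^sub>m P) *\<^sub>v x + (A\<^sup>T * P * B) *\<^sub>v u) @\<^sub>v ((B\<^sup>T * P * A) *\<^sub>v x + (B\<^sup>T * P * B) *\<^sub>v u)"
    unfolding X_def by (rule four_block_mat_mult_vec) (use A B P x u in auto)
  also have "(A\<^sup>T * P * A - \<rho>\<^sup>2 \<cdot>\<^sub>m P) *\<^sub>v x = A\<^sup>T *\<^sub>v Pa - \<rho>\<^sup>2 \<cdot>\<^sub>v (P *\<^sub>v x)"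
    using A P x abh by (simp add: minus_mult_distrib_mat_vec[of _ K K] smult_mat_mult_vec[of _ K K]
      assoc_mult_mat_vec[of _ K K _ K] Pa_def a_def)
  also have "(A\<^sup>T * P * B) *\<^sub>v u = A\<^sup>T *\<^sub>v Pb"
    using A B P u abh by (simp add: assoc_mult_mat_vec[of _ K K _ K] assoc_mult_mat_vec[of _ K K _ k] Pb_def b_def)
  also have "(B\<^sup>T * P * A) *\<^sub>v x = B\<^sup>T *\<^sub>v Pa"
    using A B P x abh by (simp add: assoc_mult_mat_vec[of _ k K _ K] Pa_def a_def)
  also have "(B\<^sup>T * P * B) *\<^sub>v u = B\<^sup>T *\<^sub>v Pb"
    using A B P u abh by (simp add: assoc_mult_mat_vec[of _ k K _ K] assoc_mult_mat_vec[of _ k K _ k] Pb_def b_def)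
  finally have Xzu: "X *\<^sub>v (x @\<^sub>v u) =
      (A\<^sup>T *\<^sub>v Pa - \<rho>\<^sup>2 \<cdot>\<^sub>v (P *\<^sub>v x) + A\<^sup>T *\<^sub>v Pb) @\<^sub>v (B\<^sup>T *\<^sub>v Pa + B\<^sup>T *\<^sub>v Pb)" .
  have "(x @\<^sub>v u) \<bullet> (X *\<^sub>v (x @\<^sub>v u)) =
      x \<bullet> (A\<^sup>T *\<^sub>v Pa - \<rho>\<^sup>2 \<cdot>\<^sub>v (P *\<^sub>v x) + A\<^sup>T *\<^sub>v Pb) + u \<bullet> (B\<^sup>T *\<^sub>v Pa + B\<^sup>T *\<^sub>v Pb)"
    unfolding Xzu by (rule scalar_prod_append) (use x u A B Pab in auto)
  also have "\<dots> = a \<bullet> Pa - \<rho>\<^sup>2 * (x \<bullet> (P *\<^sub>v x)) + a \<bullet> Pb + (b \<bullet> Pa + b \<bullet> Pb)"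
    using A B x u Pab
    by (simp add: scalar_prod_add_distrib[of _ K] scalar_prod_add_distrib[of _ k]
        scalar_prod_minus_distrib[of _ K] scalar_prod_transpose_mult[of A K K]
        scalar_prod_transpose_mult[of B K k] a_def b_def)
  also have "\<dots> = (a + b) \<bullet> (P *\<^sub>v (a + b)) - \<rho>\<^sup>2 * (x \<bullet> (P *\<^sub>v x))"
    using P abh Pab by (simp add: mult_add_distrib_mat_vec[of _ K K] scalar_prod_add_distrib[of _ K]
      add_scalar_prod_distrib[of _ K] flip: Pa_def Pb_def)
  finally have Xz: "(x @\<^sub>v u) \<bullet> (X *\<^sub>v (x @\<^sub>v u)) = (a + b) \<bullet> (P *\<^sub>v (a + b)) - \<rho>\<^sup>2 * (x \<bullet> (P *\<^sub>v x))" .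
  have "Y *\<^sub>v (x @\<^sub>v u) = (C\<^sup>T @\<^sub>r D\<^sup>T) *\<^sub>v (M *\<^sub>v (append_cols C D *\<^sub>v (x @\<^sub>v u)))"
    using CD M z by (simp add: Y_def assoc_mult_mat_vec[of _ "K + k" r _ "K + k"] assoc_mult_mat_vec[of _ "K + k" r _ r])
  also have "\<dots> = (C\<^sup>T *\<^sub>v Mh) @\<^sub>v (D\<^sup>T *\<^sub>v Mh)"
    using C D x u Pab by (simp add: append_cols_mult_vec mat_mult_append[of _ K r] Mh_def h_def)
  finally have "(x @\<^sub>v u) \<bullet> (Y *\<^sub>v (x @\<^sub>v u)) = h \<bullet> Mh"
    using C D x u Pab by (simp add: scalar_prod_append[of _ K _ k] scalar_prod_transpose_mult[of C r K]
      scalar_prod_transpose_mult[of D r k] h_def add_scalar_prod_distrib[of _ r])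
  moreover have "(x @\<^sub>v u) \<bullet> ((X + Y) *\<^sub>v (x @\<^sub>v u)) \<le> 0"
    using nsd z X Y unfolding eq neg_semidef_mat_def by auto
  moreover have "(x @\<^sub>v u) \<bullet> ((X + Y) *\<^sub>v (x @\<^sub>v u)) =
      (x @\<^sub>v u) \<bullet> (X *\<^sub>v (x @\<^sub>v u)) + (x @\<^sub>v u) \<bullet> (Y *\<^sub>v (x @\<^sub>v u))"
    using X Y z by (simp add: add_mult_distrib_mat_vec[of _ "K + k" "K + k"] scalar_prod_add_distrib[of _ "K + k"])
  ultimately show ?thesis using Xz by (simp add: a_def b_def h_def Mh_def)
qed

text \<open>\<open>filter_fix\<close> is a definite description, so its carrier is known only once
  the fixed point exists and is unique. Both follow from the trivial kernel of
  \<open>1 - A_Psi\<close>: a kernel vector would be an eigenvector for the eigenvalue 1, which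
  Schur stability, stated over the complex numbers, excludes.\<close>

lemma filter_fix_carrier:
  assumes F: "stable_filter d p q F" and y: "y \<in> carrier_vec d" and u: "u \<in> carrier_vec d"
  shows "filter_fix F y u \<in> carrier_vec (p * d)"
proof -
  have A: "A_Psi F \<in> carrier_mat (p * d) (p * d)" and By: "By_Psi F \<in> carrier_mat (p * d) d"
    and Bu: "Bu_Psi F \<in> carrier_mat (p * d) d" and schur: "schur_stable (A_Psi F)"
    using F kron_form_carrier[of d _ 1] kron_form_carrier[of d p p]
    by (auto simp: stable_filter_def)
  define b where "b = By_Psi F *\<^sub>v y + Bu_Psi F *\<^sub>v u"
  have b: "b \<in> carrier_vec (p * d)" using By Bu y u by (auto simp: b_def)
  have fix_iff: "\<zeta> = filter_next F \<zeta> y u \<longleftrightarrow> (1\<^sub>m (p * d) - A_Psi F) *\<^sub>v \<zeta> = b"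
    if \<zeta>: "\<zeta> \<in> carrier_vec (p * d)" for \<zeta>
  proof -
    have next_eq: "filter_next F \<zeta> y u = A_Psi F *\<^sub>v \<zeta> + b"
      using A By Bu y u \<zeta> by (simp add: filter_next_def b_def assoc_add_vec[of _ "p * d"])
    have minus_eq: "(1\<^sub>m (p * d) - A_Psi F) *\<^sub>v \<zeta> = \<zeta> - A_Psi F *\<^sub>v \<zeta>"
      using A \<zeta> by (simp add: minus_mult_distrib_mat_vec[of _ "p * d" "p * d"])
    have A\<zeta>: "A_Psi F *\<^sub>v \<zeta> \<in> carrier_vec (p * d)" using A \<zeta> by simp
    show ?thesis
      unfolding next_eq minus_eq using diff_vec_eq_iff[OF \<zeta> A\<zeta> b] by simp
  qed
  have ker: "v = 0\<^sub>v (p * d)"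
    if v: "v \<in> carrier_vec (p * d)" and "(1\<^sub>m (p * d) - A_Psi F) *\<^sub>v v = 0\<^sub>v (p * d)" for v
  proof (rule ccontr)
    assume nz: "v \<noteq> 0\<^sub>v (p * d)"
    have minus_eq: "(1\<^sub>m (p * d) - A_Psi F) *\<^sub>v v = v - A_Psi F *\<^sub>v v"
      using A v by (simp add: minus_mult_distrib_mat_vec[of _ "p * d" "p * d"])
    have Av: "A_Psi F *\<^sub>v v \<in> carrier_vec (p * d)" using A v by simp
    have "v - A_Psi F *\<^sub>v v = 0\<^sub>v (p * d)" using that(2) minus_eq by simp
    then have "A_Psi F *\<^sub>v v = v"
      using Av v diff_vec_eq_iff[OF v Av, of "0\<^sub>v (p * d)"] by simp
    then have "eigenvalue (A_Psi F) 1"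
      using A v nz unfolding eigenvalue_def eigenvector_def by (intro exI[of _ v]) auto
    then have "eigenvalue (map_mat complex_of_real (A_Psi F)) (complex_of_real 1)"
      by (rule of_real_hom.eigenvalue_hom[OF A])
    then show False using schur unfolding schur_stable_def by force
  qed
  have N: "1\<^sub>m (p * d) - A_Psi F \<in> carrier_mat (p * d) (p * d)" using A by (rule minus_carrier_mat)
  obtain \<zeta> where \<zeta>: "\<zeta> \<in> carrier_vec (p * d)" "(1\<^sub>m (p * d) - A_Psi F) *\<^sub>v \<zeta> = b"
    using solve_of_trivial_kernel[OF N ker b] by blast
  have "\<zeta>' = \<zeta>" if \<zeta>': "\<zeta>' \<in> carrier_vec (p * d)" "(1\<^sub>m (p * d) - A_Psi F) *\<^sub>v \<zeta>' = b" for \<zeta>'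
  proof -
    have "(1\<^sub>m (p * d) - A_Psi F) *\<^sub>v (\<zeta>' - \<zeta>) = 0\<^sub>v (p * d)"
      using \<zeta> \<zeta>' b N by (simp add: mult_minus_distrib_mat_vec[of _ "p * d" "p * d"])
    then have "\<zeta>' - \<zeta> = 0\<^sub>v (p * d)" using ker \<zeta> \<zeta>' by simp
    then show ?thesis using diff_vec_eq_iff[OF \<zeta>'(1) \<zeta>(1), of "0\<^sub>v (p * d)"] \<zeta>(1) by simp
  qed
  then have "filter_fix F y u = \<zeta>"
    unfolding filter_fix_def carrier_matD(1)[OF A] using \<zeta> fix_iff
    by (intro the_equality) blast+
  then show ?thesis using \<zeta> by simp
qed

text \<open>The truncated constraint holds on the one-step window \<open>t = T = 0\<close> and for
  every initial filter state, so it becomes a static inequality with a free filter state. Linearity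
  of the output turns \<open>h - hs\<close> into the output for the differences of the
  signals.\<close>

lemma IQC_pointwise:
  fixes f :: "real ^ 'd \<Rightarrow> real"
  assumes iqc: "truncated_hard_IQC \<F> F M" and f: "f \<in> \<F>"
    and F: "stable_filter CARD('d) p q F"
    and \<zeta>: "\<zeta> \<in> carrier_vec (p * CARD('d))"
  shows "0 \<le> filter_out F \<zeta> (vec_of (y - y')) (vec_of (grad f y - grad f y'))
    \<bullet> (M *\<^sub>v filter_out F \<zeta> (vec_of (y - y')) (vec_of (grad f y - grad f y')))"
proof -
  let ?d = "CARD('d)"
  have A: "A_Psi F \<in> carrier_mat (p * ?d) (p * ?d)" and C: "C_Psi F \<in> carrier_mat (q * ?d) (p * ?d)"
    and Dy: "Dy_Psi F \<in> carrier_mat (q * ?d) ?d" and Du: "Du_Psi F \<in> carrier_mat (q * ?d) ?d"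
    using F kron_form_carrier[of ?d _ 1] kron_form_carrier[of ?d _ p]
    by (auto simp: stable_filter_def)
  define \<zeta>s where "\<zeta>s = filter_fix F (vec_of y') (vec_of (grad f y'))"
  have \<zeta>s: "\<zeta>s \<in> carrier_vec (p * ?d)"
    unfolding \<zeta>s_def by (rule filter_fix_carrier[OF F]) simp_all
  \<comment> \<open>Offsetting the initial state by \<open>\<zeta>s\<close> makes its deviation from
    the fixed point of the filter equal to the prescribed \<open>\<zeta>\<close>.\<close>
  let ?h = "filter_out F (\<zeta> + \<zeta>s) (vec_of y) (vec_of (grad f y))"
  let ?hs = "filter_out F \<zeta>s (vec_of y') (vec_of (grad f y'))"
  have "\<zeta> + \<zeta>s \<in> carrier_vec (dim_row (A_Psi F))" using A \<zeta> \<zeta>s by simp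
  from iqc[unfolded truncated_hard_IQC_def Let_def, THEN bspec, OF f, THEN bspec, OF this,
      THEN spec[of _ "\<lambda>_. y"], THEN spec[of _ y'], THEN spec[of _ 0], THEN spec[of _ 0]]
  have "0 \<le> (?h - ?hs) \<bullet> (M *\<^sub>v (?h - ?hs))" by (simp add: \<zeta>s_def)
  moreover have "?h - ?hs = filter_out F \<zeta> (vec_of (y - y')) (vec_of (grad f y - grad f y'))"
  proof -
    note distribs = mult_add_distrib_mat_vec[OF C] mult_minus_distrib_mat_vec[OF Dy]
      mult_minus_distrib_mat_vec[OF Du]
    have car: "C_Psi F *\<^sub>v z \<in> carrier_vec (q * ?d)" if "z \<in> carrier_vec (p * ?d)" for z
      using C that by simp
    have car': "Dy_Psi F *\<^sub>v vec_of z \<in> carrier_vec (q * ?d)" "Du_Psi F *\<^sub>v vec_of z \<in> carrier_vec (q * ?d)"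
      for z :: "real ^ 'd" using Dy Du by (auto intro!: mult_mat_vec_carrier)
    show ?thesis
      unfolding filter_out_def vec_of_diff
      by (simp add: distribs \<zeta> \<zeta>s)
        (use car[OF \<zeta>] car[OF \<zeta>s] car'[of y] car'[of y'] car'[of "grad f y"] car'[of "grad f y'"]
         in \<open>auto simp: vec_eq_iff carrier_matD[OF C] carrier_matD[OF Dy] carrier_matD[OF Du]\<close>)
  qed
  ultimately show ?thesis by simp
qed

section \<open>The transformed and the augmented system\<close>

lemma tens_append:
  assumes a: "a \<in> carrier_vec k" and b: "b \<in> carrier_vec l" and v: "v \<in> carrier_vec d"
  shows "tens (a @\<^sub>v b) v = tens a v @\<^sub>v tens b v"
proof (rule eq_vecI)
  fix i assume "i < dim_vec (tens a v @\<^sub>v tens b v)"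
  then have i: "i < k * d + l * d" using a b v by (simp add: tens_def)
  then have d: "0 < d" by (auto intro: gr0I)
  show "vec_index (tens (a @\<^sub>v b) v) i = vec_index (tens a v @\<^sub>v tens b v) i"
  proof (cases "i < k * d")
    case True
    then have "i div d < k" by (simp add: less_mult_imp_div_less)
    then show ?thesis using a b v i True by (simp add: tens_def distrib_right)
  next
    case False
    then obtain j where j: "i = k * d + j" by (metis le_iff_add not_less)
    then have "j < l * d" using i by simp
    then have "j div d < l" by (simp add: less_mult_imp_div_less)
    then show ?thesis using a b v i d j \<open>j < l * d\<close> by (simp add: tens_def distrib_right)
  qed
qed (use a b v in \<open>simp add: tens_def distrib_right\<close>)

lemma tens_smult: "tens (c \<cdot>\<^sub>v a) v = c \<cdot>\<^sub>v tens a v"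
proof (rule eq_vecI)
  fix i assume "i < dim_vec (c \<cdot>\<^sub>v tens a v)"
  then have i: "i < dim_vec a * dim_vec v" by (simp add: tens_def)
  then have "i div dim_vec v < dim_vec a" by (simp add: less_mult_imp_div_less)
  then show "vec_index (tens (c \<cdot>\<^sub>v a) v) i = vec_index (c \<cdot>\<^sub>v tens a v) i"
    using i by (simp add: tens_def)
qed (simp add: tens_def)

lemma tens_zero: "v \<in> carrier_vec d \<Longrightarrow> tens (0\<^sub>v k) v = 0\<^sub>v (k * d)"
  by (rule eq_vecI) (auto simp: tens_def less_mult_imp_div_less)

lemma tens_unit_one: "v \<in> carrier_vec d \<Longrightarrow> tens (unit_vec 1 0) v = v"
  by (rule eq_vecI) (auto simp: tens_def)

section \<open>The transformed coordinates and the integrator\<close>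

locale transformed_algorithm =
  fixes d n :: nat and c1 :: real and G :: algorithm
  assumes n: "1 < n" and form: "algorithm_form d n G"
    and C1: "C1 G = c1 \<cdot>\<^sub>m 1\<^sub>m d" and c1: "c1 \<noteq> 0"
begin

text \<open>Written with \<open>n - Suc 0\<close>, the form into which the simplifier turns
  \<open>n - 1\<close>.\<close>

lemma block_dim [simp]: "d + (n - Suc 0) * d = n * d"
  using n by (cases n) auto

lemma block_carriers:
  "C1 G \<in> carrier_mat d d" "C2 G \<in> carrier_mat d ((n - 1) * d)"
  "A21 G \<in> carrier_mat ((n - 1) * d) d" "A22 G \<in> carrier_mat ((n - 1) * d) ((n - 1) * d)"
  using form kron_form_carrier[of d 1 1] kron_form_carrier[of d 1 "n - 1"]
    kron_form_carrier[of d "n - 1" 1] kron_form_carrier[of d "n - 1" "n - 1"]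
  by (auto simp: algorithm_form_def)

lemma C1_mult: "y \<in> carrier_vec d \<Longrightarrow> C1 G *\<^sub>v y = c1 \<cdot>\<^sub>v y"
  by (simp add: C1 smult_mat_mult_vec[of _ d d])

lemma trafo_carrier: "trafo d n G \<in> carrier_mat (n * d) (n * d)"
  using four_block_carrier_mat[OF block_carriers(1), of "1\<^sub>m ((n - 1) * d)" "(n - 1) * d" "(n - 1) * d"]
  by (simp add: trafo_def)

lemma trafo_mult_vec:
  assumes y: "y \<in> carrier_vec d" and z: "z \<in> carrier_vec ((n - 1) * d)"
  shows "trafo d n G *\<^sub>v (y @\<^sub>v z) = (c1 \<cdot>\<^sub>v y + C2 G *\<^sub>v z) @\<^sub>v z"
proof -
  have "trafo d n G *\<^sub>v (y @\<^sub>v z) =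
      (C1 G *\<^sub>v y + C2 G *\<^sub>v z) @\<^sub>v (0\<^sub>m ((n - 1) * d) d *\<^sub>v y + 1\<^sub>m ((n - 1) * d) *\<^sub>v z)"
    unfolding trafo_def by (rule four_block_mat_mult_vec) (use block_carriers y z in auto)
  also have "0\<^sub>m ((n - 1) * d) d *\<^sub>v y + 1\<^sub>m ((n - 1) * d) *\<^sub>v z = z"
    using y z by (intro eq_vecI) auto
  finally show ?thesis using C1_mult[OF y] by simp
qed

lemma split_state:
  assumes "a \<in> carrier_vec (n * d)"
  obtains y z where "y \<in> carrier_vec d" "z \<in> carrier_vec ((n - 1) * d)" "a = y @\<^sub>v z"
proof
  show "a = vec_first a d @\<^sub>v vec_last a ((n - 1) * d)"
    using assms by simp
qed auto

text \<open>\<open>trafo\<close> is block upper triangular with invertible diagonal blocks, so its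
  kernel is trivial. Hence \<open>mat_inverse\<close> succeeds, and the \<open>the\<close> in
  \<open>A_tilde\<close> denotes a genuine inverse.\<close>

lemma trafo_inverse:
  obtains Ti where "Ti \<in> carrier_mat (n * d) (n * d)" "trafo d n G * Ti = 1\<^sub>m (n * d)"
    "the (mat_inverse (trafo d n G)) = Ti"
proof -
  have ker: "a = 0\<^sub>v (n * d)"
    if a: "a \<in> carrier_vec (n * d)" and 0: "trafo d n G *\<^sub>v a = 0\<^sub>v (n * d)" for a
  proof -
    obtain y z where yz: "y \<in> carrier_vec d" "z \<in> carrier_vec ((n - 1) * d)" "a = y @\<^sub>v z"
      using split_state[OF a] .
    have C2z: "C2 G *\<^sub>v z \<in> carrier_vec d" using block_carriers yz by auto
    have "(0\<^sub>v (d + k) :: real Matrix.vec) = 0\<^sub>v d @\<^sub>v 0\<^sub>v k" for k by (intro eq_vecI) auto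
    from this[of "(n - 1) * d"] have split0: "(0\<^sub>v (n * d) :: real Matrix.vec) = 0\<^sub>v d @\<^sub>v 0\<^sub>v ((n - 1) * d)"
      by simp
    have "c1 \<cdot>\<^sub>v y + C2 G *\<^sub>v z = 0\<^sub>v d \<and> z = 0\<^sub>v ((n - 1) * d)"
      using 0 trafo_mult_vec[OF yz(1,2)] append_vec_eq[of "c1 \<cdot>\<^sub>v y + C2 G *\<^sub>v z" d "0\<^sub>v d"] yz(1) C2z
      unfolding yz(3) split0 by auto
    then have z0: "z = 0\<^sub>v ((n - 1) * d)" and "c1 \<cdot>\<^sub>v y + C2 G *\<^sub>v 0\<^sub>v ((n - 1) * d) = 0\<^sub>v d"
      by auto
    moreover have "C2 G *\<^sub>v 0\<^sub>v ((n - 1) * d) = 0\<^sub>v d"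
      using block_carriers(2) by (intro eq_vecI) auto
    ultimately have "c1 \<cdot>\<^sub>v y = 0\<^sub>v d" using yz(1) by simp
    then have "y = 0\<^sub>v d" using c1 yz(1) by (auto simp: vec_eq_iff)
    then show ?thesis using z0 yz(3) split0 by (simp only:)
  qed
  then have "det (trafo d n G) \<noteq> 0"
    using det_0_iff_vec_prod_zero_field[OF trafo_carrier] by blast
  from det_non_zero_imp_unit[OF trafo_carrier this, where b = "()"]
  have "mat_inverse (trafo d n G) \<noteq> None"
    using mat_inverse(1)[OF trafo_carrier, where b = "()"] by blast
  then obtain Ti where "mat_inverse (trafo d n G) = Some Ti" by blast
  with mat_inverse(2)[OF trafo_carrier this] show ?thesis
    by (intro that[of Ti]) simp_all
qed

lemma core_carrier:
  "four_block_mat (1\<^sub>m d) (0\<^sub>m d ((n - 1) * d)) (A21 G) (A22 G) \<in> carrier_mat (n * d) (n * d)"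
  using four_block_carrier_mat[OF one_carrier_mat[of d] block_carriers(4)] by simp

lemma A_tilde_carrier: "A_tilde d n G \<in> carrier_mat (n * d) (n * d)"
proof -
  obtain Ti where Ti: "Ti \<in> carrier_mat (n * d) (n * d)" "the (mat_inverse (trafo d n G)) = Ti"
    using trafo_inverse by blast
  show ?thesis unfolding A_tilde_def Ti(2) using Ti(1) trafo_carrier core_carrier by simp
qed

lemma B_tilde_carrier: "B_tilde d n G \<in> carrier_mat (n * d) d"
  using carrier_append_rows[OF block_carriers(1), of "0\<^sub>m ((n - 1) * d) d" "(n - 1) * d"]
  by (simp add: B_tilde_def)

lemma C_tilde_carrier: "C_tilde d n \<in> carrier_mat d (n * d)"
  using append_cols_carrier[of "1\<^sub>m d" d d "0\<^sub>m d ((n - 1) * d)" "(n - 1) * d"]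
  by (simp add: C_tilde_def)

lemma C_tilde_mult_vec:
  assumes a: "a \<in> carrier_vec (n * d)"
  shows "C_tilde d n *\<^sub>v a = vec_first a d"
proof -
  have "C_tilde d n *\<^sub>v (vec_first a d @\<^sub>v vec_last a ((n - 1) * d)) =
      1\<^sub>m d *\<^sub>v vec_first a d + 0\<^sub>m d ((n - 1) * d) *\<^sub>v vec_last a ((n - 1) * d)"
    unfolding C_tilde_def by (rule append_cols_mult_vec) auto
  also have "\<dots> = vec_first a d" by (intro eq_vecI) auto
  finally show ?thesis using a by simp
qed

text \<open>
  The integrator row of the algorithm, \<open>\<xi>\<^sup>(\<^sup>1\<^sup>) \<mapsto> \<xi>\<^sup>(\<^sup>1\<^sup>) + u\<close>, reads in the transformed coordinates as a left
  eigenvector of \<open>A_tilde\<close> for the eigenvalue 1; it is the first block row of the inverse of \<open>trafo\<close>.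
\<close>

lemma integrator_row:
  obtains w where "w \<in> carrier_vec n"
    "\<And>v y z. v \<in> carrier_vec d \<Longrightarrow> y \<in> carrier_vec d \<Longrightarrow> z \<in> carrier_vec ((n - 1) * d) \<Longrightarrow>
      tens w v \<bullet> (trafo d n G *\<^sub>v (y @\<^sub>v z)) = v \<bullet> y"
proof -
  obtain C20 where C20: "C20 \<in> carrier_mat 1 (n - 1)" "C2 G = kron C20 (1\<^sub>m d)"
    using form by (auto simp: algorithm_form_def kron_form_def)
  define r where "r = C20\<^sup>T *\<^sub>v unit_vec 1 0"
  have r: "r \<in> carrier_vec (n - 1)" using C20(1) by (simp add: r_def)
  \<comment> \<open>Solving \<open>s = c1 y + C2 z\<close> for \<open>y\<close> gives
    \<open>y = (s - C2 z) / c1\<close>; \<open>w\<close> collects these coefficients, with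
    \<open>r\<close> the transposed row of the Kronecker factor of \<open>C2\<close>.\<close>
  define w where "w = (1 / c1) \<cdot>\<^sub>v unit_vec 1 0 @\<^sub>v (- (1 / c1)) \<cdot>\<^sub>v r"
  have "1 + (n - 1) = n" using n by simp
  moreover have "w \<in> carrier_vec (1 + (n - 1))"
    unfolding w_def using r by (intro append_carrier_vec) auto
  ultimately have w: "w \<in> carrier_vec n" by simp
  have "tens w v \<bullet> (trafo d n G *\<^sub>v (y @\<^sub>v z)) = v \<bullet> y"
    if v: "v \<in> carrier_vec d" and y: "y \<in> carrier_vec d" and z: "z \<in> carrier_vec ((n - 1) * d)" for v y z
  proof -
    have "tens w v = (1 / c1) \<cdot>\<^sub>v v @\<^sub>v (- (1 / c1)) \<cdot>\<^sub>v tens r v"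
      using r v unfolding w_def
      by (simp only: tens_append[of _ 1 _ "n - 1" _ d] smult_carrier_vec unit_vec_carrier tens_smult tens_unit_one)
    moreover have "tens r v = (C2 G)\<^sup>T *\<^sub>v v"
    proof -
      have "(C2 G)\<^sup>T *\<^sub>v v = kron C20\<^sup>T (1\<^sub>m d) *\<^sub>v tens (unit_vec 1 0) v"
        unfolding C20(2) transpose_kron tens_unit_one[OF v] by simp
      also have "\<dots> = tens r v"
        unfolding r_def using C20(1) v by (intro kron_mult_tens[of _ "n - 1" 1]) auto
      finally show ?thesis ..
    qed
    moreover have "((C2 G)\<^sup>T *\<^sub>v v) \<bullet> z = v \<bullet> (C2 G *\<^sub>v z)"
      using transpose_vec_mult_scalar[OF block_carriers(2) z v] .
    moreover have "(C2 G)\<^sup>T *\<^sub>v v \<in> carrier_vec ((n - 1) * d)" "C2 G *\<^sub>v z \<in> carrier_vec d"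
      using block_carriers v z by auto
    ultimately show ?thesis
      using v y z c1 by (simp add: trafo_mult_vec scalar_prod_append[of _ d _ "(n - 1) * d"]
          scalar_prod_add_distrib[of _ d] field_simps)
  qed
  then show ?thesis using that w by blast
qed

text \<open>The row \<open>w\<close> reads the integrator state off the transformed coordinates.
  \<open>A_tilde\<close> is conjugate to a matrix whose first block row is the identity followed by
  zeros, so it preserves this state.\<close>

lemma tilde_left_eigenvector:
  obtains w where "w \<in> carrier_vec n"
    "\<And>v a. v \<in> carrier_vec d \<Longrightarrow> a \<in> carrier_vec (n * d) \<Longrightarrow>
      tens w v \<bullet> (A_tilde d n G *\<^sub>v a) = tens w v \<bullet> a"
    "\<And>v u. v \<in> carrier_vec d \<Longrightarrow> u \<in> carrier_vec d \<Longrightarrow> tens w v \<bullet> (B_tilde d n G *\<^sub>v u) = v \<bullet> u"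
proof -
  obtain w where w: "w \<in> carrier_vec n"
    and row: "\<And>v y z. v \<in> carrier_vec d \<Longrightarrow> y \<in> carrier_vec d \<Longrightarrow> z \<in> carrier_vec ((n - 1) * d) \<Longrightarrow>
      tens w v \<bullet> (trafo d n G *\<^sub>v (y @\<^sub>v z)) = v \<bullet> y"
    using integrator_row by blast
  obtain Ti where Ti: "Ti \<in> carrier_mat (n * d) (n * d)" "trafo d n G * Ti = 1\<^sub>m (n * d)"
    "the (mat_inverse (trafo d n G)) = Ti"
    using trafo_inverse by blast
  let ?T = "trafo d n G" and ?J = "four_block_mat (1\<^sub>m d) (0\<^sub>m d ((n - 1) * d)) (A21 G) (A22 G)"
  have "tens w v \<bullet> (A_tilde d n G *\<^sub>v a) = tens w v \<bullet> a"
    if v: "v \<in> carrier_vec d" and a: "a \<in> carrier_vec (n * d)" for v a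
  proof -
    have Tia: "Ti *\<^sub>v a \<in> carrier_vec (n * d)" using Ti a by simp
    obtain y z where yz: "y \<in> carrier_vec d" "z \<in> carrier_vec ((n - 1) * d)" "Ti *\<^sub>v a = y @\<^sub>v z"
      using split_state[OF Tia] .
    let ?z = "A21 G *\<^sub>v y + A22 G *\<^sub>v z"
    have z': "?z \<in> carrier_vec ((n - 1) * d)" using block_carriers yz by auto
    have "?J *\<^sub>v (y @\<^sub>v z) = (1\<^sub>m d *\<^sub>v y + 0\<^sub>m d ((n - 1) * d) *\<^sub>v z) @\<^sub>v ?z"
      by (rule four_block_mat_mult_vec) (use block_carriers yz in auto)
    also have "1\<^sub>m d *\<^sub>v y + 0\<^sub>m d ((n - 1) * d) *\<^sub>v z = y"
      using yz by (intro eq_vecI) auto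
    finally have J: "?J *\<^sub>v (y @\<^sub>v z) = y @\<^sub>v ?z" .
    have "A_tilde d n G *\<^sub>v a = ?T *\<^sub>v (?J *\<^sub>v (Ti *\<^sub>v a))"
      unfolding A_tilde_def Ti(3)
      using assoc_mult_mat_vec[OF mult_carrier_mat[OF trafo_carrier core_carrier] Ti(1) a]
        assoc_mult_mat_vec[OF trafo_carrier core_carrier Tia] by (simp only:)
    then have "tens w v \<bullet> (A_tilde d n G *\<^sub>v a) = v \<bullet> y"
      using row[OF v yz(1) z'] by (simp only: yz(3) J)
    also have "\<dots> = tens w v \<bullet> (?T *\<^sub>v (Ti *\<^sub>v a))"
      using row[OF v yz(1,2)] by (simp only: yz(3))
    also have "?T *\<^sub>v (Ti *\<^sub>v a) = a"
      using assoc_mult_mat_vec[OF trafo_carrier Ti(1) a] Ti(2) a by simp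
    finally show ?thesis .
  qed
  moreover have "tens w v \<bullet> (B_tilde d n G *\<^sub>v u) = v \<bullet> u"
    if v: "v \<in> carrier_vec d" and u: "u \<in> carrier_vec d" for v u
  proof -
    have "B_tilde d n G *\<^sub>v u = (C1 G *\<^sub>v u) @\<^sub>v (0\<^sub>m ((n - 1) * d) d *\<^sub>v u)"
      unfolding B_tilde_def using block_carriers u by (intro mat_mult_append) auto
    also have "0\<^sub>m ((n - 1) * d) d *\<^sub>v u = 0\<^sub>v ((n - 1) * d)"
      using u by (intro eq_vecI) auto
    \<comment> \<open>The input enters as the image of \<open>(u, 0)\<close>, that is, as a pure
      addition of \<open>u\<close> to the integrator state.\<close>
    also have "(C1 G *\<^sub>v u) @\<^sub>v 0\<^sub>v ((n - 1) * d) = ?T *\<^sub>v (u @\<^sub>v 0\<^sub>v ((n - 1) * d))"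
    proof -
      have "C2 G *\<^sub>v 0\<^sub>v ((n - 1) * d) = 0\<^sub>v d"
        using block_carriers(2) by (intro eq_vecI) auto
      then show ?thesis using u by (simp add: trafo_mult_vec C1_mult)
    qed
    finally show ?thesis using row[OF v u, of "0\<^sub>v ((n - 1) * d)"] by simp
  qed
  ultimately show ?thesis using that w by blast
qed

end

section \<open>The algorithm augmented by the filter\<close>

locale augmented_system = transformed_algorithm +
  fixes p q :: nat and F :: lin_filter
  assumes filter: "stable_filter d p q F"
begin

lemma filter_carriers:
  "A_Psi F \<in> carrier_mat (p * d) (p * d)" "By_Psi F \<in> carrier_mat (p * d) d"
  "Bu_Psi F \<in> carrier_mat (p * d) d" "C_Psi F \<in> carrier_mat (q * d) (p * d)"
  "Dy_Psi F \<in> carrier_mat (q * d) d" "Du_Psi F \<in> carrier_mat (q * d) d"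
  using filter kron_form_carrier[of d _ 1] kron_form_carrier[of d _ p]
  by (auto simp: stable_filter_def)

lemma A_hat_carrier: "A_hat d n p G F \<in> carrier_mat ((n + p) * d) ((n + p) * d)"
  using four_block_carrier_mat[OF A_tilde_carrier filter_carriers(1)]
  by (simp add: A_hat_def distrib_right)

lemma B_hat_carrier: "B_hat d n G F \<in> carrier_mat ((n + p) * d) d"
  using carrier_append_rows[OF B_tilde_carrier filter_carriers(3)]
  by (simp add: B_hat_def distrib_right)

lemma C_hat_carrier: "C_hat d n F \<in> carrier_mat (q * d) ((n + p) * d)"
  using append_cols_carrier[OF mult_carrier_mat[OF filter_carriers(5) C_tilde_carrier] filter_carriers(4)]
  by (simp add: C_hat_def distrib_right)

lemma D_hat_carrier: "D_hat F \<in> carrier_mat (q * d) d"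
  using filter_carriers(6) by (simp add: D_hat_def)

lemma split_augmented:
  assumes "x \<in> carrier_vec ((n + p) * d)"
  obtains a b where "a \<in> carrier_vec (n * d)" "b \<in> carrier_vec (p * d)" "x = a @\<^sub>v b"
proof
  show "x = vec_first x (n * d) @\<^sub>v vec_last x (p * d)"
    using assms by (simp add: distrib_right)
qed auto

lemma vec_first_append:
  assumes "a \<in> carrier_vec (n * d)"
  shows "vec_first (a @\<^sub>v b) d = vec_first a d"
  using assms n by (intro eq_vecI) (auto simp: vec_first_def trans_less_add1 less_le_trans)

text \<open>This links the output matrices of the matrix inequality with the filter output that the
  quadratic constraint speaks of.\<close>

lemma output_hat:
  assumes x: "a \<in> carrier_vec (n * d)" "b \<in> carrier_vec (p * d)" and u: "u \<in> carrier_vec d"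
  shows "C_hat d n F *\<^sub>v (a @\<^sub>v b) + D_hat F *\<^sub>v u = filter_out F b (vec_first a d) u"
proof -
  have "C_hat d n F *\<^sub>v (a @\<^sub>v b) = Dy_Psi F * C_tilde d n *\<^sub>v a + C_Psi F *\<^sub>v b"
    unfolding C_hat_def
    by (rule append_cols_mult_vec[OF mult_carrier_mat[OF filter_carriers(5) C_tilde_carrier] filter_carriers(4) x])
  also have "Dy_Psi F * C_tilde d n *\<^sub>v a = Dy_Psi F *\<^sub>v vec_first a d"
    using assoc_mult_mat_vec[OF filter_carriers(5) C_tilde_carrier x(1)] x by (simp add: C_tilde_mult_vec)
  also have "Dy_Psi F *\<^sub>v vec_first a d + C_Psi F *\<^sub>v b = C_Psi F *\<^sub>v b + Dy_Psi F *\<^sub>v vec_first a d"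
    using filter_carriers x by (intro comm_add_vec[of _ "q * d"]) auto
  finally show ?thesis by (simp add: filter_out_def D_hat_def)
qed

text \<open>\<open>A_hat\<close> is block lower triangular: the filter does not feed back into the
  algorithm. The left eigenvector of \<open>A_tilde\<close>, padded with zeros on the filter states,
  therefore keeps its property.\<close>

lemma hat_left_eigenvector:
  obtains w where "w \<in> carrier_vec (n + p)"
    "\<And>v x u. v \<in> carrier_vec d \<Longrightarrow> x \<in> carrier_vec ((n + p) * d) \<Longrightarrow> u \<in> carrier_vec d \<Longrightarrow>
      tens w v \<bullet> (A_hat d n p G F *\<^sub>v x + B_hat d n G F *\<^sub>v u) = tens w v \<bullet> x + v \<bullet> u"
proof -
  obtain w0 where w0: "w0 \<in> carrier_vec n"
    and eigA: "\<And>v a. v \<in> carrier_vec d \<Longrightarrow> a \<in> carrier_vec (n * d) \<Longrightarrow>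
      tens w0 v \<bullet> (A_tilde d n G *\<^sub>v a) = tens w0 v \<bullet> a"
    and eigB: "\<And>v u. v \<in> carrier_vec d \<Longrightarrow> u \<in> carrier_vec d \<Longrightarrow> tens w0 v \<bullet> (B_tilde d n G *\<^sub>v u) = v \<bullet> u"
    using tilde_left_eigenvector by blast
  define w where "w = w0 @\<^sub>v 0\<^sub>v p"
  have w: "w \<in> carrier_vec (n + p)" using w0 by (simp add: w_def)
  have "tens w v \<bullet> (A_hat d n p G F *\<^sub>v x + B_hat d n G F *\<^sub>v u) = tens w v \<bullet> x + v \<bullet> u"
    if v: "v \<in> carrier_vec d" and x: "x \<in> carrier_vec ((n + p) * d)" and u: "u \<in> carrier_vec d" for v x u
  proof -
    obtain a b where ab: "a \<in> carrier_vec (n * d)" "b \<in> carrier_vec (p * d)" "x = a @\<^sub>v b"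
      using split_augmented[OF x] .
    have tw: "tens w v = tens w0 v @\<^sub>v 0\<^sub>v (p * d)"
      using tens_append[OF w0 zero_carrier_vec v] v by (simp add: w_def tens_zero)
    have tw0: "tens w0 v \<in> carrier_vec (n * d)" using w0 v by simp
    have low: "tens w v \<bullet> (s @\<^sub>v t) = tens w0 v \<bullet> s"
      if "s \<in> carrier_vec (n * d)" "t \<in> carrier_vec (p * d)" for s t
      unfolding tw using scalar_prod_append[OF tw0 zero_carrier_vec that] that by simp
    have Ax: "A_hat d n p G F *\<^sub>v x = (A_tilde d n G *\<^sub>v a + 0\<^sub>m (n * d) (p * d) *\<^sub>v b) @\<^sub>v
        (By_Psi F * C_tilde d n *\<^sub>v a + A_Psi F *\<^sub>v b)"
      unfolding A_hat_def ab(3)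
      by (rule four_block_mat_mult_vec[OF A_tilde_carrier zero_carrier_mat
            mult_carrier_mat[OF filter_carriers(2) C_tilde_carrier] filter_carriers(1) ab(1,2)])
    have Aa: "A_tilde d n G *\<^sub>v a \<in> carrier_vec (n * d)"
      using A_tilde_carrier ab(1) by simp
    have "A_tilde d n G *\<^sub>v a + 0\<^sub>m (n * d) (p * d) *\<^sub>v b = A_tilde d n G *\<^sub>v a"
    proof -
      have "0\<^sub>m (n * d) (p * d) *\<^sub>v b = 0\<^sub>v (n * d)" using ab(2) by (intro eq_vecI) auto
      then show ?thesis using Aa by simp
    qed
    moreover have "By_Psi F * C_tilde d n *\<^sub>v a + A_Psi F *\<^sub>v b \<in> carrier_vec (p * d)"
      using mult_carrier_mat[OF filter_carriers(2) C_tilde_carrier] filter_carriers(1) ab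
      by (intro add_carrier_vec mult_mat_vec_carrier)
    ultimately have "tens w v \<bullet> (A_hat d n p G F *\<^sub>v x) = tens w v \<bullet> x"
      using low[OF Aa] low[OF ab(1,2)] eigA[OF v ab(1)] unfolding Ax by (simp add: ab(3))
    moreover have "B_hat d n G F *\<^sub>v u = (B_tilde d n G *\<^sub>v u) @\<^sub>v (Bu_Psi F *\<^sub>v u)"
      unfolding B_hat_def by (rule mat_mult_append[OF B_tilde_carrier filter_carriers(3) u])
    then have "tens w v \<bullet> (B_hat d n G F *\<^sub>v u) = v \<bullet> u"
      using low[OF mult_mat_vec_carrier[OF B_tilde_carrier u] mult_mat_vec_carrier[OF filter_carriers(3) u]]
        eigB[OF v u] by simp
    ultimately show ?thesis
      using scalar_prod_add_distrib[OF tens_carrier[OF w v] mult_mat_vec_carrier[OF A_hat_carrier x]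
          mult_mat_vec_carrier[OF B_hat_carrier u]] by simp
  qed
  then show ?thesis using that w by blast
qed

end

section \<open>Weighted projections and fixed points\<close>

lemma first_block_plus:
  assumes "x \<in> carrier_vec (CARD('d) + k)" "y \<in> carrier_vec (CARD('d) + k)"
  shows "(first_block (x + y) :: real ^ 'd) = first_block x + first_block y"
proof -
  have "vec_of (first_block (x + y) :: real ^ 'd) - vec_of (first_block y :: real ^ 'd)
      = vec_of (first_block x :: real ^ 'd)"
    using assms by (simp add: vec_of_first_block vec_first_plus) (auto simp: vec_eq_iff vec_first_def)
  then have "(first_block (x + y) :: real ^ 'd) - first_block y = first_block x"
    by (simp flip: vec_of_diff add: vec_of_inject)
  then show ?thesis by (simp add: algebra_simps)
qed

lemma first_block_minus:
  assumes "x \<in> carrier_vec (CARD('d) + k)" "y \<in> carrier_vec (CARD('d) + k)"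
  shows "(first_block (x - y) :: real ^ 'd) = first_block x - first_block y"
proof -
  have "vec_of (first_block (x - y) :: real ^ 'd) = vec_of (first_block x - first_block y :: real ^ 'd)"
    using vec_first_minus[OF assms] by (simp add: vec_of_first_block vec_of_diff)
  then show ?thesis by (simp add: vec_of_inject)
qed

locale weighted_projection =
  fixes N :: nat and P0 P :: "real mat" and \<Omega> :: "(real ^ 'd) set"
  assumes N: "0 < N" and P0: "P0 \<in> carrier_mat N N" and P_kron: "P = kron P0 (1\<^sub>m CARD('d))"
    and pos_def: "pos_def_mat P"
    and \<Omega>: "\<Omega> \<noteq> {}" "closed \<Omega>" "convex \<Omega>"
begin

sublocale weighted_space "N * CARD('d)" P
  by unfold_locales (use P0 P_kron pos_def in auto)

lemma state_dim [simp]: "CARD('d) + (N - Suc 0) * CARD('d) = N * CARD('d)"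
  using N by (cases N) auto

lemma first_block_plus_state:
  assumes "x \<in> carrier_vec (N * CARD('d))" "y \<in> carrier_vec (N * CARD('d))"
  shows "(first_block (x + y) :: real ^ 'd) = first_block x + first_block y"
  using first_block_plus[where 'd = 'd, of x "(N - Suc 0) * CARD('d)" y] assms by simp

lemma first_block_minus_state:
  assumes "x \<in> carrier_vec (N * CARD('d))" "y \<in> carrier_vec (N * CARD('d))"
  shows "(first_block (x - y) :: real ^ 'd) = first_block x - first_block y"
  using first_block_minus[where 'd = 'd, of x "(N - Suc 0) * CARD('d)" y] assms by simp

lemma first_block_tens:
  assumes "a \<in> carrier_vec N"
  shows "first_block (tens a (vec_of v)) = vec_index a 0 *\<^sub>R (v :: real ^ 'd)"
proof -
  have "vec_of (first_block (tens a (vec_of v)) :: real ^ 'd) = vec_of (vec_index a 0 *\<^sub>R v)"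
    using vec_first_tens[OF assms N vec_of_carrier[of v]] by (simp add: vec_of_first_block vec_of_scaleR)
  then show ?thesis by (simp add: vec_of_inject)
qed

lemma scalar_prod_first_block:
  assumes "x \<in> carrier_vec (N * CARD('d))"
  shows "tens (unit_vec N 0) (vec_of v) \<bullet> x = inner v (first_block x :: real ^ 'd)"
proof -
  have "(vec_of v @\<^sub>v 0\<^sub>v ((N - 1) * CARD('d))) \<bullet> x = vec_of v \<bullet> vec_first x CARD('d)"
    by (rule append_zero_scalar_prod) (use assms in simp_all)
  then show ?thesis
    by (simp add: tens_unit[OF N vec_of_carrier] flip: vec_of_scalar_prod vec_of_first_block)
qed

text \<open>By the symmetry of \<open>P\<close> the Kronecker factor moves onto \<open>a\<close>.
  Choosing \<open>a\<close> as a preimage under \<open>P0\<close> makes any row of the form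
  \<open>w \<otimes> v\<close> available as a weighted inner product.\<close>

lemma ip_tens:
  assumes a: "a \<in> carrier_vec N" and v: "v \<in> carrier_vec CARD('d)" and y: "y \<in> carrier_vec (N * CARD('d))"
  shows "ip (tens a v) y = tens (P0 *\<^sub>v a) v \<bullet> y"
proof -
  have t: "tens a v \<in> carrier_vec (N * CARD('d))" using a v by simp
  have "ip (tens a v) y = y \<bullet> (P *\<^sub>v tens a v)"
    using ip_comm[OF t y] by (simp add: ip_def)
  also have "P *\<^sub>v tens a v = tens (P0 *\<^sub>v a) v"
    unfolding P_kron by (rule kron_mult_tens[OF P0 a v])
  finally show ?thesis
    using comm_scalar_prod[OF y tens_carrier[OF mult_mat_vec_carrier[OF P0 a] v]] by simp
qed

text \<open>Definiteness of \<open>P\<close> is tested on \<open>a \<otimes> e_1\<close>, where the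
  quadratic form factors and \<open>e_1\<close> contributes 1.\<close>

lemma P0_pos:
  assumes a: "a \<in> carrier_vec N" and nz: "a \<noteq> 0\<^sub>v N"
  shows "0 < a \<bullet> (P0 *\<^sub>v a)"
proof -
  let ?v = "unit_vec CARD('d) 0"
  have d: "0 < CARD('d)" by simp
  have P0a: "P0 *\<^sub>v a \<in> carrier_vec N" using P0 a by simp
  have t: "tens a ?v \<in> carrier_vec (N * CARD('d))" using a by simp
  obtain i where i: "i < N" "vec_index a i \<noteq> 0"
    using nz a by (auto simp: vec_eq_iff)
  have "i * CARD('d) < N * CARD('d)" using i(1) d by simp
  then have "vec_index (tens a ?v) (i * CARD('d)) \<noteq> 0"
    using a i by (simp add: tens_def)
  then have "tens a ?v \<noteq> 0\<^sub>v (N * CARD('d))"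
    using \<open>i * CARD('d) < N * CARD('d)\<close> by auto
  then have "0 < ip (tens a ?v) (tens a ?v)" using ip_pos[OF t] by simp
  also have "\<dots> = (P0 *\<^sub>v a) \<bullet> a"
    using a t P0a by (simp add: ip_tens tens_scalar_prod[of _ N _ _ "CARD('d)"] scalar_prod_right_unit)
  finally show ?thesis using comm_scalar_prod[OF a P0a] by simp
qed

lemma P0_solve:
  assumes "b \<in> carrier_vec N"
  obtains a where "a \<in> carrier_vec N" "P0 *\<^sub>v a = b"
proof (rule solve_of_trivial_kernel[OF P0 _ assms])
  fix v assume v: "v \<in> carrier_vec N" "P0 *\<^sub>v v = 0\<^sub>v N"
  then show "v = 0\<^sub>v N" using P0_pos[of v] by fastforce
qed

text \<open>The first column of the inverse of \<open>P0\<close>.\<close>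

definition g :: "real Matrix.vec" where
  "g = (SOME g. g \<in> carrier_vec N \<and> P0 *\<^sub>v g = unit_vec N 0)"

lemma g: "g \<in> carrier_vec N" "P0 *\<^sub>v g = unit_vec N 0"
proof -
  have "\<exists>g. g \<in> carrier_vec N \<and> P0 *\<^sub>v g = unit_vec N 0"
    using P0_solve[of "unit_vec N 0"] by auto
  from someI_ex[OF this] show "g \<in> carrier_vec N" "P0 *\<^sub>v g = unit_vec N 0"
    unfolding g_def by auto
qed

text \<open>The leading entry of \<open>g\<close> equals \<open>g \<bullet> P0 g\<close>, so
  definiteness of \<open>P0\<close> applies. The projection formula below divides by it.\<close>

lemma g_pos: "0 < vec_index g 0"
proof -
  have "g \<noteq> 0\<^sub>v N"
  proof
    assume "g = 0\<^sub>v N"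
    then have "P0 *\<^sub>v g = 0\<^sub>v N" using P0 by (intro eq_vecI) auto
    then have "vec_index (unit_vec N 0 :: real Matrix.vec) 0 = vec_index (0\<^sub>v N) 0" using g(2) by simp
    then show False using N by simp
  qed
  then have "0 < g \<bullet> unit_vec N 0" using P0_pos[OF g(1)] g(2) by simp
  then show ?thesis using g(1) N by (simp add: scalar_prod_right_unit)
qed

text \<open>
  Among the states with a prescribed first block, the one closest to \<open>x\<close> differs from \<open>x\<close> by a multiple
  \<open>g \<otimes> v\<close>, because its \<open>P\<close>-image is supported on the first block. Hence the weighted projection onto
  \<open>\<Omega> \<times> \<real>\<^sup>k\<close> projects the first block in the Euclidean sense.
\<close>

definition proj :: "real Matrix.vec \<Rightarrow> real Matrix.vec" where
  "proj x = x + tens ((1 / vec_index g 0) \<cdot>\<^sub>v g)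
     (vec_of (closest_point \<Omega> (first_block x) - first_block x))"

lemma correction_carrier:
  "tens ((1 / vec_index g 0) \<cdot>\<^sub>v g) (vec_of (v :: real ^ 'd)) \<in> carrier_vec (N * CARD('d))"
  using g(1) by simp

lemma proj_carrier: "x \<in> carrier_vec (N * CARD('d)) \<Longrightarrow> proj x \<in> carrier_vec (N * CARD('d))"
  unfolding proj_def using correction_carrier by simp

lemma first_block_proj:
  assumes "x \<in> carrier_vec (N * CARD('d))"
  shows "first_block (proj x) = closest_point \<Omega> (first_block x)"
proof -
  \<comment> \<open>This normalization makes the correction move the first block by exactly the
    displacement to the closest point.\<close>
  have "vec_index ((1 / vec_index g 0) \<cdot>\<^sub>v g) 0 = 1"
    using g_pos g(1) N by simp
  then show ?thesis
    using assms g(1) unfolding proj_def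
    by (simp add: first_block_plus_state correction_carrier first_block_tens)
qed

lemma proj_minus:
  assumes "x \<in> carrier_vec (N * CARD('d))"
  shows "proj x - x = tens ((1 / vec_index g 0) \<cdot>\<^sub>v g)
    (vec_of (closest_point \<Omega> (first_block x) - first_block x))"
  using assms carrier_vecD[OF correction_carrier] unfolding proj_def by (intro eq_vecI) auto

text \<open>Since \<open>P0\<close> maps \<open>g\<close> to the first unit vector, the correction
  pairs with the first block of \<open>y\<close> alone.\<close>

lemma ip_proj_minus:
  assumes x: "x \<in> carrier_vec (N * CARD('d))" and y: "y \<in> carrier_vec (N * CARD('d))"
  shows "ip (proj x - x) y =
    inner (closest_point \<Omega> (first_block x) - first_block x) (first_block y) / vec_index g 0"
proof -
  let ?v = "closest_point \<Omega> (first_block x) - first_block x"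
  have "ip (proj x - x) y = tens (P0 *\<^sub>v ((1 / vec_index g 0) \<cdot>\<^sub>v g)) (vec_of ?v) \<bullet> y"
    unfolding proj_minus[OF x] using g(1) y by (intro ip_tens) auto
  also have "P0 *\<^sub>v ((1 / vec_index g 0) \<cdot>\<^sub>v g) = (1 / vec_index g 0) \<cdot>\<^sub>v unit_vec N 0"
    using mult_mat_vec[OF P0 g(1)] g(2) by simp
  also have "tens \<dots> (vec_of ?v) \<bullet> y = (1 / vec_index g 0) * (tens (unit_vec N 0) (vec_of ?v) \<bullet> y)"
    unfolding tens_smult
    by (rule smult_scalar_prod_distrib[OF tens_carrier[OF unit_vec_carrier vec_of_carrier] y])
  finally show ?thesis using scalar_prod_first_block[OF y] by simp
qed

text \<open>Up to the positive factor \<open>1 / g_0\<close> this is the obtuse-angle property of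
  the Euclidean closest point in \<open>\<Omega>\<close>.\<close>

lemma proj_variational:
  assumes x: "x \<in> carrier_vec (N * CARD('d))" and z: "z \<in> carrier_vec (N * CARD('d))"
    and z1: "first_block z \<in> \<Omega>"
  shows "0 \<le> ip (proj x - x) (z - proj x)"
proof -
  let ?c = "closest_point \<Omega> (first_block x)"
  have "inner (first_block x - ?c) (first_block z - ?c) \<le> 0"
    using \<Omega> z1 by (intro closest_point_dot) auto
  then have "0 \<le> inner (?c - first_block x) (first_block z - ?c)"
    by (simp add: inner_diff_left)
  then show ?thesis
    using x z proj_carrier[OF x] g_pos
    by (simp add: ip_proj_minus first_block_minus_state first_block_proj)
qed

lemma lift_set_eq:
  "x \<in> lift_set ((N - 1) * CARD('d)) \<Omega> \<longleftrightarrow> x \<in> carrier_vec (N * CARD('d)) \<and> first_block x \<in> \<Omega>"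
  by (simp add: lift_set_iff)

text \<open>\<open>wproj\<close> picks some minimizer, so the identification requires
  \<open>proj x\<close> to be the strict one. Expanding the square of
  \<open>z - x = (z - proj x) + (proj x - x)\<close> gives a cross term that is nonnegative by the
  variational inequality and a square that is positive for \<open>z \<noteq> proj x\<close>.\<close>

lemma wproj_eq_proj:
  assumes x: "x \<in> carrier_vec (N * CARD('d))"
  shows "wproj P (lift_set ((N - 1) * CARD('d)) \<Omega>) x = proj x"
proof -
  let ?D = "lift_set ((N - 1) * CARD('d)) \<Omega>"
  have px: "proj x \<in> carrier_vec (N * CARD('d))" "proj x \<in> ?D"
    using proj_carrier[OF x] first_block_proj[OF x] closest_point_in_set[OF \<Omega>(2,1)]
    by (simp_all add: lift_set_eq del: One_nat_def)
  have less: "(wnorm P (proj x - x))\<^sup>2 < (wnorm P (z - x))\<^sup>2" if z: "z \<in> ?D" "z \<noteq> proj x" for z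
  proof -
    have zc: "z \<in> carrier_vec (N * CARD('d))" "first_block z \<in> \<Omega>"
      using z(1) by (simp_all add: lift_set_eq del: One_nat_def)
    have "z - proj x \<noteq> 0\<^sub>v (N * CARD('d))"
      using diff_vec_eq_iff[OF zc(1) px(1), of "0\<^sub>v (N * CARD('d))"] z(2) px(1) by simp
    then have "0 < ip (z - proj x) (z - proj x)" using zc px by (intro ip_pos) auto
    moreover have "0 \<le> ip (proj x - x) (z - proj x)" using proj_variational[OF x zc] .
    moreover have "ip (z - x) (z - x) =
        ip (proj x - x) (proj x - x) + 2 * ip (proj x - x) (z - proj x) + ip (z - proj x) (z - proj x)"
      using x zc px by (simp add: ip_simps ip_comm[of z x] ip_comm[of "proj x" x] ip_comm[of z "proj x"])
    ultimately show ?thesis using x zc px by (simp add: wnorm_sq)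
  qed
  show ?thesis
    unfolding wproj_def arg_min_on_def arg_min_def
  proof (rule some_equality)
    show "is_arg_min (\<lambda>z. (wnorm P (z - x))\<^sup>2) (\<lambda>z. z \<in> ?D) (proj x)"
      unfolding is_arg_min_def using px less by (metis less_asym)
    fix z assume "is_arg_min (\<lambda>z. (wnorm P (z - x))\<^sup>2) (\<lambda>z. z \<in> ?D) z"
    then show "z = proj x" unfolding is_arg_min_def using px less by blast
  qed
qed

text \<open>Adding the variational inequalities at \<open>x\<close> and at \<open>y\<close>, each
  tested with the other projection, gives firm nonexpansiveness; Cauchy-Schwarz and cancellation of
  one norm finish.\<close>

lemma proj_nonexpansive:
  assumes x: "x \<in> carrier_vec (N * CARD('d))" and y: "y \<in> carrier_vec (N * CARD('d))"
  shows "wnorm P (proj x - proj y) \<le> wnorm P (x - y)"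
proof -
  have c: "proj x \<in> carrier_vec (N * CARD('d))" "proj y \<in> carrier_vec (N * CARD('d))"
    "first_block (proj x) \<in> \<Omega>" "first_block (proj y) \<in> \<Omega>"
    using proj_carrier x y first_block_proj closest_point_in_set[OF \<Omega>(2,1)] by auto
  have "0 \<le> ip (proj x - x) (proj y - proj x)" "0 \<le> ip (proj y - y) (proj x - proj y)"
    using proj_variational x y c by auto
  then have "ip (proj x - proj y) (proj x - proj y) \<le> ip (x - y) (proj x - proj y)"
    using x y c by (simp add: ip_simps ip_comm[of "proj x" "proj y"])
  also have "\<dots> \<le> wnorm P (x - y) * wnorm P (proj x - proj y)"
    using ip_le_wnorm[of "x - y" "proj x - proj y"] x y c by simp
  finally have "wnorm P (proj x - proj y) * wnorm P (proj x - proj y) \<le> wnorm P (x - y) * wnorm P (proj x - proj y)"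
    using c by (simp flip: wnorm_sq power2_eq_square)
  then show ?thesis
    using wnorm_nonneg[of "proj x - proj y"] wnorm_nonneg[of "x - y"] x y c
    by (cases "wnorm P (proj x - proj y) = 0") (auto simp: mult_le_cancel_right)
qed

text \<open>
  Moving along the integrator direction \<open>a \<otimes> v\<close> with \<open>P\<^sub>0 a = w\<close>, the contraction property forces the
  gradient to decrease in the direction \<open>v\<close>, which contradicts monotonicity unless \<open>w \<bullet> g \<le> 0\<close>.
\<close>

lemma integrator_gain_nonpos:
  fixes u :: "real ^ 'd \<Rightarrow> real ^ 'd"
  assumes T: "\<And>x. x \<in> carrier_vec (N * CARD('d)) \<Longrightarrow> T x \<in> carrier_vec (N * CARD('d))"
    and contr: "\<And>x y. x \<in> carrier_vec (N * CARD('d)) \<Longrightarrow> y \<in> carrier_vec (N * CARD('d)) \<Longrightarrow>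
      wnorm P (T x - T y) \<le> \<rho> * wnorm P (x - y)"
    and \<rho>: "\<rho> < 1"
    and mono: "\<And>x y. 0 \<le> inner (u x - u y) (x - y)"
    and w: "w \<in> carrier_vec N"
    and eig: "\<And>v x. x \<in> carrier_vec (N * CARD('d)) \<Longrightarrow>
      tens w (vec_of v) \<bullet> T x = tens w (vec_of v) \<bullet> x + inner v (u (first_block x))"
  shows "w \<bullet> g \<le> 0"
proof (cases "w = 0\<^sub>v N")
  case True
  then show ?thesis using g(1) by simp
next
  case False
  obtain a where a: "a \<in> carrier_vec N" "P0 *\<^sub>v a = w" using P0_solve[OF w] .
  have "a \<noteq> 0\<^sub>v N"
  proof
    assume "a = 0\<^sub>v N"
    then have "P0 *\<^sub>v a = 0\<^sub>v N" using P0 by (intro eq_vecI) auto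
    then show False using a False by simp
  qed
  then have s: "0 < w \<bullet> a"
    using P0_pos[OF a(1)] a comm_scalar_prod[OF a(1) w] by simp
  \<comment> \<open>An arbitrary coordinate direction, taken for its unit length.\<close>
  define v :: "real ^ 'd" where "v = axis undefined 1"
  have vv: "vec_of v \<bullet> vec_of v = 1"
    by (simp add: vec_of_scalar_prod v_def inner_axis_axis)
  let ?X = "tens a (vec_of v)" and ?O = "0\<^sub>v (N * CARD('d))"
  have X: "?X \<in> carrier_vec (N * CARD('d))" using a by simp
  have tg: "tens g (vec_of v) \<in> carrier_vec (N * CARD('d))" using g by simp
  have tw: "tens w (vec_of v) \<in> carrier_vec (N * CARD('d))" using w by simp
  have "ip ?X (tens g (vec_of v)) = w \<bullet> g"
    using ip_tens[OF a(1) vec_of_carrier[of v] tg] a(2) tens_scalar_prod[OF w g(1) vec_of_carrier[of v] vec_of_carrier[of v]] vv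
    by simp
  moreover have "ip (tens g (vec_of v)) ?X = vec_index a 0"
    using ip_tens[OF g(1) vec_of_carrier[of v] X] g(2) a(1) N vv
      tens_scalar_prod[OF unit_vec_carrier a(1) vec_of_carrier[of v] vec_of_carrier[of v]]
    by simp
  \<comment> \<open>Both computations evaluate the weighted inner product of
    \<open>a \<otimes> v\<close> and \<open>g \<otimes> v\<close>: moving \<open>P0\<close> onto
    \<open>a\<close> gives \<open>w \<bullet> g\<close>, moving it onto \<open>g\<close> gives the
    leading entry of \<open>a\<close>.\<close>
  ultimately have a0: "vec_index a 0 = w \<bullet> g"
    using ip_comm[OF X tg] by simp
  have XX: "ip ?X ?X = w \<bullet> a"
    using ip_tens[OF a(1) vec_of_carrier[of v] X] a(2) tens_scalar_prod[OF w a(1) vec_of_carrier[of v] vec_of_carrier[of v]] vv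
    by simp
  have fX: "first_block ?X = vec_index a 0 *\<^sub>R v" using first_block_tens[OF a(1)] .
  have f0: "first_block ?O = (0 :: real ^ 'd)"
    using first_block_minus_state[OF X X] X by simp
  have "ip ?X (T ?X - T ?O) = tens w (vec_of v) \<bullet> (T ?X - T ?O)"
    using ip_tens[OF a(1) vec_of_carrier[of v], of "T ?X - T ?O"] a(2) T X by simp
  also have "\<dots> = tens w (vec_of v) \<bullet> ?X + inner v (u (vec_index a 0 *\<^sub>R v) - u 0)"
    using scalar_prod_minus_distrib[OF tw T[OF X] T[of ?O]] eig[OF X, of v] eig[of ?O v] tw fX f0
    by (simp add: inner_diff_right)
  also have "tens w (vec_of v) \<bullet> ?X = w \<bullet> a"
    using tens_scalar_prod[OF w a(1) vec_of_carrier[of v] vec_of_carrier[of v]] vv by simp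
  \<comment> \<open>Cauchy-Schwarz against \<open>?X\<close> followed by the contraction bounds the
    left side by \<open>\<rho>\<close> times \<open>ip ?X ?X = w \<bullet> a\<close>, so the
    gradient term must be negative.\<close>
  finally have "w \<bullet> a + inner v (u (vec_index a 0 *\<^sub>R v) - u 0) \<le> wnorm P ?X * wnorm P (T ?X - T ?O)"
    using ip_le_wnorm[OF X, of "T ?X - T ?O"] T X by simp
  also have "\<dots> \<le> wnorm P ?X * (\<rho> * wnorm P ?X)"
    using contr[OF X, of ?O] X wnorm_nonneg[OF X] by (intro mult_left_mono) auto
  also have "\<dots> = \<rho> * (w \<bullet> a)"
    using wnorm_sq[OF X] XX by (simp add: power2_eq_square)
  also have "\<dots> < w \<bullet> a" using s \<rho> by simp
  finally have "inner v (u (vec_index a 0 *\<^sub>R v) - u 0) < 0" by simp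
  \<comment> \<open>Monotonicity is applied at the first blocks of the two states,
    \<open>a_0 v\<close> and 0. With the negative gradient term it forces
    \<open>a_0 \<le> 0\<close>.\<close>
  moreover have "0 \<le> vec_index a 0 * inner v (u (vec_index a 0 *\<^sub>R v) - u 0)"
    using mono[of "vec_index a 0 *\<^sub>R v" 0] by (simp add: inner_commute)
  ultimately have "vec_index a 0 \<le> 0" by (simp add: zero_le_mult_iff)
  then show ?thesis using a0 by simp
qed

text \<open>The pairing of \<open>w \<otimes> h\<close> with \<open>x - T x\<close> is computed
  twice: from the projection, where \<open>x - T x\<close> is
  \<open>- (g \<otimes> \<nu>) / g_0\<close> with \<open>\<nu>\<close> normal to
  \<open>\<Omega>\<close> at the first block, and from the integrator identity. The comparison
  writes the claimed quantity as a product of two nonpositive numbers over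
  \<open>g_0 > 0\<close>.\<close>

lemma fixed_point_variational:
  fixes u :: "real ^ 'd \<Rightarrow> real ^ 'd"
  assumes Tx: "T x \<in> carrier_vec (N * CARD('d))" and x: "x \<in> carrier_vec (N * CARD('d))"
    and fixed: "x = proj (T x)"
    and w: "w \<in> carrier_vec N" and gain: "w \<bullet> g \<le> 0"
    and eig: "\<And>v. tens w (vec_of v) \<bullet> T x = tens w (vec_of v) \<bullet> x + inner v (u (first_block x))"
    and z: "z \<in> \<Omega>"
  shows "0 \<le> inner (u (first_block x)) (z - first_block x)"
proof -
  define h where "h = z - (first_block x :: real ^ 'd)"
  define \<nu> where "\<nu> = first_block (T x) - (first_block x :: real ^ 'd)"
  have x1: "first_block x = closest_point \<Omega> (first_block (T x))"
    using first_block_proj[OF Tx] fixed by simp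
  have normal: "inner \<nu> h \<le> 0"
    unfolding \<nu>_def h_def x1 using \<Omega> z by (intro closest_point_dot) auto
  have "x - T x = tens ((1 / vec_index g 0) \<cdot>\<^sub>v g) (vec_of (- \<nu>))"
    using proj_minus[OF Tx] x1 by (simp add: \<nu>_def flip: fixed)
  then have "tens w (vec_of h) \<bullet> (x - T x) = ((1 / vec_index g 0) * (w \<bullet> g)) * inner h (- \<nu>)"
    using tens_scalar_prod[OF w _ vec_of_carrier vec_of_carrier, of "(1 / vec_index g 0) \<cdot>\<^sub>v g" h "- \<nu>"] g(1) w
    by (simp add: vec_of_scalar_prod)
  moreover have "tens w (vec_of h) \<bullet> (x - T x) = - inner h (u (first_block x))"
    using scalar_prod_minus_distrib[OF tens_carrier[OF w vec_of_carrier] x Tx] eig[of h] by simp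
  ultimately have "inner (u (first_block x)) h = (w \<bullet> g) * inner \<nu> h / vec_index g 0"
    by (simp add: inner_commute)
  then show ?thesis
    using normal gain g_pos by (simp add: h_def mult_nonpos_nonpos)
qed

end

section \<open>Convergence of the projected algorithm\<close>

text \<open>The dissipation inequality is applied to \<open>x - y\<close> and the gradient
  difference. Its output term is nonnegative by the pointwise constraint, taken at the filter part
  \<open>b\<close> of \<open>x - y\<close>; a square root of what remains gives the claim.\<close>

lemma (in weighted_projection) augmented_contraction:
  fixes f :: "real ^ 'd \<Rightarrow> real"
  assumes sys: "augmented_system CARD('d) n c1 G p q F" and N_eq: "N = n + p"
    and M: "M \<in> carrier_mat (q * CARD('d)) (q * CARD('d))"
    and iqc: "truncated_hard_IQC \<F> F M" and f: "f \<in> \<F>" and \<rho>: "0 \<le> \<rho>"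
    and nsd: "neg_semidef_mat (LMI_mat (A_hat CARD('d) n p G F) (B_hat CARD('d) n G F)
      (C_hat CARD('d) n F) (D_hat F) P M \<rho>)"
    and x: "x \<in> carrier_vec (N * CARD('d))" and y: "y \<in> carrier_vec (N * CARD('d))"
  defines "T \<equiv> \<lambda>x. A_hat CARD('d) n p G F *\<^sub>v x + B_hat CARD('d) n G F *\<^sub>v vec_of (grad f (first_block x))"
  shows "wnorm P (T x - T y) \<le> \<rho> * wnorm P (x - y)"
proof -
  interpret augmented_system "CARD('d)" n c1 G p q F by (rule sys)
  let ?A = "A_hat CARD('d) n p G F" and ?B = "B_hat CARD('d) n G F"
  let ?u = "\<lambda>x. grad f (first_block x)"
  let ?du = "vec_of (?u x - ?u y)"
  note carriers = A_hat_carrier[folded N_eq] B_hat_carrier[folded N_eq] C_hat_carrier[folded N_eq]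
  have xy: "x - y \<in> carrier_vec (N * CARD('d))" using x y by simp
  have Tc: "T z \<in> carrier_vec (N * CARD('d))" if "z \<in> carrier_vec (N * CARD('d))" for z
    unfolding T_def
    by (intro add_carrier_vec mult_mat_vec_carrier[OF carriers(1) that]
        mult_mat_vec_carrier[OF carriers(2) vec_of_carrier])
  have "T x - T y = (?A *\<^sub>v x - ?A *\<^sub>v y) + (?B *\<^sub>v vec_of (?u x) - ?B *\<^sub>v vec_of (?u y))"
    using carrier_matD[OF carriers(1)] carrier_matD[OF carriers(2)]
    unfolding T_def by (intro eq_vecI) (simp_all del: index_mult_mat_vec)
  also have "?A *\<^sub>v x - ?A *\<^sub>v y = ?A *\<^sub>v (x - y)"
    using mult_minus_distrib_mat_vec[OF carriers(1) x y] by simp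
  also have "?B *\<^sub>v vec_of (?u x) - ?B *\<^sub>v vec_of (?u y) = ?B *\<^sub>v ?du"
    using mult_minus_distrib_mat_vec[OF carriers(2) vec_of_carrier[of "?u x"] vec_of_carrier[of "?u y"]]
    by (simp add: vec_of_diff)
  finally have diff: "T x - T y = ?A *\<^sub>v (x - y) + ?B *\<^sub>v ?du" .
  obtain a b where ab: "a \<in> carrier_vec (n * CARD('d))" "b \<in> carrier_vec (p * CARD('d))" "x - y = a @\<^sub>v b"
    using split_augmented[OF xy[unfolded N_eq]] .
  have "vec_first a CARD('d) = vec_first (x - y) CARD('d)"
    unfolding ab(3) vec_first_append[OF ab(1)] ..
  also have "\<dots> = vec_of (first_block x - first_block y :: real ^ 'd)"
    using first_block_minus_state[OF x y] by (simp flip: vec_of_first_block)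
  finally have "C_hat CARD('d) n F *\<^sub>v (x - y) + D_hat F *\<^sub>v ?du =
      filter_out F b (vec_of (first_block x - first_block y :: real ^ 'd)) ?du"
    using output_hat[OF ab(1,2) vec_of_carrier[of "?u x - ?u y"]] unfolding ab(3) by simp
  then have "0 \<le> (C_hat CARD('d) n F *\<^sub>v (x - y) + D_hat F *\<^sub>v ?du)
      \<bullet> (M *\<^sub>v (C_hat CARD('d) n F *\<^sub>v (x - y) + D_hat F *\<^sub>v ?du))"
    using IQC_pointwise[OF iqc f filter ab(2), of "first_block x" "first_block y"] by simp
  moreover note LMI_quadratic_form[OF carriers(1-3) D_hat_carrier P_carrier M nsd xy vec_of_carrier[of "?u x - ?u y"]]
  ultimately have "ip (T x - T y) (T x - T y) \<le> \<rho>\<^sup>2 * ip (x - y) (x - y)"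
    unfolding diff ip_def by linarith
  then have "(wnorm P (T x - T y))\<^sup>2 \<le> (\<rho> * wnorm P (x - y))\<^sup>2"
    using xy Tc[OF x] Tc[OF y] by (simp add: wnorm_sq power_mult_distrib)
  then show ?thesis
    by (rule power2_le_imp_le) (simp add: \<rho> wnorm_nonneg[OF xy])
qed

section \<open>Fixed point, optimality and rate of the projected algorithm\<close>

theorem theorem2:
  fixes f :: "real ^ 'd \<Rightarrow> real" and \<Omega> :: "(real ^ 'd) set"
    and m L c1 \<rho> :: real and n p q :: nat
    and G :: algorithm and \<Psi> :: lin_filter and M P :: "real mat"
  defines "d \<equiv> CARD('d)"
  defines "A \<equiv> A_hat d n p G \<Psi>" and "B \<equiv> B_hat d n G \<Psi>"
    and "C \<equiv> C_hat d n \<Psi>" and "D \<equiv> D_hat \<Psi>"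
  defines "step \<equiv> proj_step A B P (lift_set ((n + p - 1) * d) \<Omega>) f"
  assumes "0 < m" and "m \<le> L" and "f \<in> S_class m L"
    and "\<Omega> \<noteq> {}" and "closed \<Omega>" and "convex \<Omega>"
    and "1 < n" and "algorithm_form d n G" and "stable_filter d p q \<Psi>"
    and assumption_A: "C1 G = c1 \<cdot>\<^sub>m 1\<^sub>m d" "c1 < 0"
    and assumption_B:
      "M \<in> carrier_mat (q * d) (q * d)" "M\<^sup>T = M"
      "truncated_hard_IQC (S_class m L :: (real ^ 'd \<Rightarrow> real) set) \<Psi> M"
      "0 < \<rho>" "\<rho> < 1"
      "kron_form d (n + p) (n + p) P" "pos_def_mat P"
      "neg_semidef_mat (LMI_mat A B C D P M \<rho>)"
  shows "\<exists>xs \<in> carrier_vec ((n + p) * d).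
           xs = step xs \<and>
           (\<forall>x \<in> carrier_vec ((n + p) * d). x = step x \<longrightarrow> x = xs) \<and>
           is_arg_min f (\<lambda>y. y \<in> \<Omega>) (first_block xs) \<and>
           (\<forall>y. is_arg_min f (\<lambda>y. y \<in> \<Omega>) y \<longrightarrow> y = first_block xs) \<and>
           (\<forall>x0 \<in> carrier_vec ((n + p) * d). R_linear (\<lambda>k. (step ^^ k) x0) xs \<rho>)"
proof -
  obtain P0 where P0: "P0 \<in> carrier_mat (n + p) (n + p)" "P = kron P0 (1\<^sub>m CARD('d))"
    using assumption_B(6) by (auto simp: kron_form_def d_def)
  interpret weighted_projection "n + p" P0 P \<Omega>
    by unfold_locales (use P0 assumption_B \<open>1 < n\<close> \<open>\<Omega> \<noteq> {}\<close> \<open>closed \<Omega>\<close> \<open>convex \<Omega>\<close> in auto)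
  have sys: "augmented_system CARD('d) n c1 G p q \<Psi>"
    by unfold_locales (use \<open>1 < n\<close> \<open>algorithm_form d n G\<close> \<open>stable_filter d p q \<Psi>\<close> assumption_A
        in \<open>auto simp: d_def\<close>)
  interpret augmented_system "CARD('d)" n c1 G p q \<Psi> by (rule sys)
  let ?u = "\<lambda>x. grad f (first_block x)"
  define T where "T x = A *\<^sub>v x + B *\<^sub>v vec_of (?u x)" for x
  have T: "T x \<in> carrier_vec ((n + p) * d)" if "x \<in> carrier_vec ((n + p) * d)" for x
    unfolding T_def A_def B_def d_def
    by (intro add_carrier_vec mult_mat_vec_carrier[OF A_hat_carrier that[unfolded d_def]]
        mult_mat_vec_carrier[OF B_hat_carrier vec_of_carrier])
  have contrT: "wnorm P (T x - T y) \<le> \<rho> * wnorm P (x - y)"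
    if "x \<in> carrier_vec ((n + p) * d)" "y \<in> carrier_vec ((n + p) * d)" for x y
    using augmented_contraction[OF sys refl _ assumption_B(3) \<open>f \<in> S_class m L\<close>, of \<rho> x y] assumption_B that
    by (simp add: T_def A_def B_def C_def D_def d_def)
  have step_eq: "step x = proj (T x)" if "x \<in> carrier_vec ((n + p) * d)" for x
    using wproj_eq_proj[OF T[OF that, unfolded d_def]] by (simp add: step_def proj_step_def T_def d_def)
  have step: "step x \<in> carrier_vec ((n + p) * d)" if "x \<in> carrier_vec ((n + p) * d)" for x
    using proj_carrier T[OF that] step_eq[OF that] by (simp add: d_def)
  have contr: "wnorm P (step x - step y) \<le> \<rho> * wnorm P (x - y)"
    if "x \<in> carrier_vec ((n + p) * d)" "y \<in> carrier_vec ((n + p) * d)" for x y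
    using proj_nonexpansive[of "T x" "T y"] contrT[OF that] T that by (simp add: step_eq d_def)
  have \<rho>: "0 \<le> \<rho>" using \<open>0 < \<rho>\<close> by simp
  obtain xs where xs: "xs \<in> carrier_vec ((n + p) * d)" "step xs = xs"
    using contraction_fixed_point[of step \<rho>] step contr \<rho> \<open>\<rho> < 1\<close> unfolding d_def by blast
  have iterates: "wnorm P ((step ^^ k) x - xs) \<le> \<rho> ^ k * wnorm P (x - xs)"
    and iterates_carrier: "(step ^^ k) x \<in> carrier_vec ((n + p) * d)"
    if x: "x \<in> carrier_vec ((n + p) * d)" for k x
  proof -
    \<comment> \<open>The orbit of \<open>xs\<close> is constant, so the contraction estimate
      compares an arbitrary orbit with \<open>xs\<close> itself.\<close>
    have "(step ^^ k) xs = xs" by (induction k) (simp_all add: xs(2))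
    then show "wnorm P ((step ^^ k) x - xs) \<le> \<rho> ^ k * wnorm P (x - xs)"
      using contraction_iterates(2)[of step \<rho> x xs k] step contr \<rho> x xs(1) by (simp add: d_def)
    show "(step ^^ k) x \<in> carrier_vec ((n + p) * d)"
      by (induction k) (use step x in auto)
  qed
  have unique: "x = xs" if x: "x \<in> carrier_vec ((n + p) * d)" "x = step x" for x
  proof -
    have xxs: "x - xs \<in> carrier_vec ((n + p) * CARD('d))" using x xs by (simp add: d_def)
    have "wnorm P (x - xs) \<le> \<rho> * wnorm P (x - xs)" using contr[OF x(1) xs(1)] x(2) xs(2) by simp
    then have "(1 - \<rho>) * wnorm P (x - xs) \<le> 0" by (simp add: algebra_simps)
    then have "wnorm P (x - xs) = 0"
      using \<open>\<rho> < 1\<close> wnorm_nonneg[OF xxs] by (simp add: mult_le_0_iff)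
    then have "x - xs = 0\<^sub>v ((n + p) * CARD('d))" using wnorm_eq_0[OF xxs] by simp
    then show ?thesis
      using diff_vec_eq_iff[of x _ xs "0\<^sub>v ((n + p) * CARD('d))"] x(1) xs(1) by (simp add: d_def)
  qed
  obtain w where w: "w \<in> carrier_vec (n + p)"
    and eig: "\<And>v x u. v \<in> carrier_vec CARD('d) \<Longrightarrow> x \<in> carrier_vec ((n + p) * CARD('d)) \<Longrightarrow>
      u \<in> carrier_vec CARD('d) \<Longrightarrow>
      tens w v \<bullet> (A_hat CARD('d) n p G \<Psi> *\<^sub>v x + B_hat CARD('d) n G \<Psi> *\<^sub>v u) = tens w v \<bullet> x + v \<bullet> u"
    using hat_left_eigenvector by blast
  have eigT: "tens w (vec_of v) \<bullet> T x = tens w (vec_of v) \<bullet> x + inner v (?u x)"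
    if "x \<in> carrier_vec ((n + p) * d)" for x and v :: "real ^ 'd"
    using eig[OF vec_of_carrier[of v] that[unfolded d_def] vec_of_carrier[of "?u x"]]
    by (simp add: T_def A_def B_def d_def vec_of_scalar_prod)
  have mono: "0 \<le> inner (grad f x - grad f y) (x - y)" for x y
  proof -
    have "m * (norm (x - y))\<^sup>2 \<le> inner (grad f x - grad f y) (x - y)"
      using \<open>f \<in> S_class m L\<close> unfolding S_class_def by blast
    moreover have "0 \<le> m * (norm (x - y))\<^sup>2" using \<open>0 < m\<close> by simp
    ultimately show ?thesis by linarith
  qed
  \<comment> \<open>The sign is obtained from the map \<open>T\<close> before projection, for which
    both the contraction and the integrator identity \<open>eigT\<close> are available.\<close>
  have gain: "w \<bullet> g \<le> 0"
    using integrator_gain_nonpos[of T \<rho> "grad f" w] T contrT \<open>\<rho> < 1\<close> mono w eigT unfolding d_def by blast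
  have fixed: "xs = proj (T xs)" using xs step_eq by simp
  have first_order: "0 \<le> inner (?u xs) (z - first_block xs)" if "z \<in> \<Omega>" for z
    using fixed_point_variational[of T xs w "grad f" z] T xs(1) fixed w gain eigT[OF xs(1)] that
    unfolding d_def by blast
  have xs_\<Omega>: "first_block xs \<in> \<Omega>"
  proof -
    have "first_block (proj (T xs)) \<in> \<Omega>"
      using first_block_proj[of "T xs"] T[OF xs(1)] closest_point_in_set[OF \<Omega>(2,1)] by (simp add: d_def)
    then show ?thesis by (simp flip: fixed)
  qed
  \<comment> \<open>Strong convexity sharpens the first-order condition to a strict inequality,
    which yields minimality and uniqueness at once.\<close>
  have strict: "f (first_block xs) < f z" if "z \<in> \<Omega>" "z \<noteq> first_block xs" for z
    using S_class_strict_tangent[OF \<open>f \<in> S_class m L\<close> \<open>0 < m\<close> that(2)] first_order[OF that(1)]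
    by linarith
  have arg_min: "is_arg_min f (\<lambda>y. y \<in> \<Omega>) (first_block xs)"
    unfolding is_arg_min_def using xs_\<Omega> strict by (metis less_asym)
  have arg_min_unique: "y = first_block xs" if "is_arg_min f (\<lambda>y. y \<in> \<Omega>) y" for y
    using that xs_\<Omega> strict unfolding is_arg_min_def by blast
  obtain c where c: "0 < c"
    "\<And>x. x \<in> carrier_vec ((n + p) * CARD('d)) \<Longrightarrow> vnorm x \<le> c * wnorm P x"
    using vnorm_le_wnorm by blast
  have rate: "R_linear (\<lambda>k. (step ^^ k) x0) xs \<rho>" if x0: "x0 \<in> carrier_vec ((n + p) * d)" for x0
    unfolding R_linear_def
  \<comment> \<open>The added 1 keeps the constant positive when the orbit starts at
    \<open>xs\<close>.\<close>
  proof (intro exI[of _ "c * wnorm P (x0 - xs) + 1"] conjI allI)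
    have "0 \<le> wnorm P (x0 - xs)" using x0 xs(1) by (intro wnorm_nonneg) (simp add: d_def)
    then show "0 < c * wnorm P (x0 - xs) + 1" using c(1) by (intro add_nonneg_pos) auto
    fix k
    have "vnorm ((step ^^ k) x0 - xs) \<le> c * wnorm P ((step ^^ k) x0 - xs)"
      using iterates_carrier[OF x0] xs(1) by (intro c(2)) (simp add: d_def)
    also have "\<dots> \<le> c * (\<rho> ^ k * wnorm P (x0 - xs))"
      using iterates[OF x0] c(1) by (intro mult_left_mono) auto
    also have "\<dots> \<le> (c * wnorm P (x0 - xs) + 1) * \<rho> ^ k"
      using \<rho> by (simp add: algebra_simps)
    finally show "vnorm ((step ^^ k) x0 - xs) \<le> (c * wnorm P (x0 - xs) + 1) * \<rho> ^ k" .
  qed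
  show ?thesis
    by (intro bexI[OF _ xs(1)] conjI ballI allI impI xs(2)[symmetric] unique arg_min arg_min_unique rate)
qed

end
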